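(* Let $X$ be a Banach space and let $(A(t),D(A(t)))_{t\in\mathbb R}$, $(B(t),D(B(t)))_{t\in\mathbb R}$ be families of linear operators on $X$. Suppose that: (a) the non-autonomous Cauchy problem for the family $(A(t)+B(t))_{t\in\mathbb R}$ is well-posed; let $W=(W(t,s))_{t\ge s}$ be the evolution family solving it, and let its evolution semigroup on $C_0(\mathbb R;X)$ be generated by the closure of $\mathcal C:=-\frac{d}{ds}+A(\cdot)+B(\cdot)$; (b) there are $M\ge1$, $\omega\in\mathbb R$ such that for every $r\in\mathbb R$ the operators $A(r)$ and $B(r)$ generate $C_0$-semigroups on $X$ with $\|e^{tA(r)}\|\le Me^{\omega t}$ and $\|e^{tB(r)}\|\le Me^{\omega t}$ for all $t\ge0$; (c) the maps $t\mapsto R(\lambda,A(t))x$ and $t\mapsto R(\lambda,B(t))x$ are continuous on $\mathbb R$ for all $\lambda>\omega$ and $x\in X$. (1) (Strang splitting) If in addition $$\sup_{s\in\mathbb R}\Bigl\|\prod_{p=n-1}^{0}e^{\frac{t}{2n}A(s-\frac{pt}{n})}e^{\frac tnB(s-\frac{pt}{n})}e^{\frac{t}{2n}A(s-\frac{pt}{n})}\Bigr\|\le Me^{\omega t}\qquad\text{for all }t\ge0,\ n\in\mathbb N,$$ then for all $x\in X$ and $t\ge s$ $$W(t,s)x=\lim_{n\to\infty}\prod_{p=0}^{n-1}e^{\frac{t-s}{2n}A(s+\frac{p(t-s)}{n})}e^{\frac{t-s}{n}B(s+\frac{p(t-s)}{n})}e^{\frac{t-s}{2n}A(s+\frac{p(t-s)}{n})}x.$$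 (2) (Symmetrically weighted splitting) If in addition $$\sup_{s\in\mathbb R}\frac1{2^n}\Bigl\|\prod_{p=n-1}^{0}\Bigl(e^{\frac tnA(s-\frac{pt}{n})}e^{\frac tnB(s-\frac{pt}{n})}+e^{\frac tnB(s-\frac{pt}{n})}e^{\frac tnA(s-\frac{pt}{n})}\Bigr)\Bigr\|\le Me^{\omega t}\qquad\text{for all }t\ge0,\ n\in\mathbb N,$$ then for all $x\in X$ and $t\ge s$ $$W(t,s)x=\lim_{n\to\infty}\frac1{2^n}\prod_{p=0}^{n-1}\Bigl(e^{\frac{t-s}{n}A(s+\frac{p(t-s)}{n})}e^{\frac{t-s}{n}B(s+\frac{p(t-s)}{n})}+e^{\frac{t-s}{n}B(s+\frac{p(t-s)}{n})}e^{\frac{t-s}{n}A(s+\frac{p(t-s)}{n})}\Bigr)x.$$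
   Context: Products are ordered: $\prod_{p=0}^{n-1}U_p:=U_{n-1}U_{n-2}\cdots U_1U_0$ and $\prod_{p=n-1}^{0}U_p:=U_0U_1\cdots U_{n-1}$. $R(\lambda,G)=(\lambda-G)^{-1}$. The sum $A(t)+B(t)$ has domain $D(A(t))\cap D(B(t))$. For a family $(G(t),D(G(t)))_{t\in\mathbb R}$ of linear operators on $X$, a classical solution of $(\mathrm{NCP})_{s,x}$: $u'(t)=G(t)u(t)$ $(t\ge s)$, $u(s)=x$, is a function $u\in C^1([s,\infty);X)$ with $u(t)\in D(G(t))$ and $u'(t)=G(t)u(t)$ for $t\ge s$, and $u(s)=x$. The problem is well-posed if: (i) for each $s$ the space $Y_s$ of all $y\in X$ such that $(\mathrm{NCP})_{s,y}$ has a classical solution is dense in $X$ (and contained in $D(G(s))$); (ii) for $y\in Y_s$ the solution $u_s(\cdot,y)$ is unique; (iii) if $s_n\to s$, $Y_{s_n}\ni y_n\to y\in Y_s$, then $\hat u_{s_n}(t,y_n)\to\hat u_s(t,y)$ uniformly for $t$ in compact subsets of $\mathbb R$, where $\hat u_r(t,y)=u_r(t,y)$ if $t\ge r$ and $=y$ if $t<r$; (iv) there are $M\ge1,\omega\in\mathbb R$ with $\|u_s(t,y)\|\le Me^{\omega(t-s)}\|y\|$ for all $y\in Y_s$, $t\ge s$. An (exponentially bounded) evolution family is a family $(U(t,s))_{t\ge s}$ in $\mathcal L(X)$ with $U(t,r)U(r,s)=U(t,s)$, $U(t,t)=I$ for $t\ge r\ge s$, $(t,s)\mapsto U(t,s)$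 strongly continuous, and $\|U(t,s)\|\le Me^{\omega(t-s)}$ for some $M\ge 1$, $\omega\in\mathbb R$. It solves the problem if for every $s$ the set of $y\in X$ for which $t\mapsto U(t,s)y$ is a classical solution of $(\mathrm{NCP})_{s,y}$ is dense in $X$. Well-posedness is equivalent to the existence of a unique evolution family solving the problem; it satisfies $U(t,s)y=u_s(t,y)$ for $y\in Y_s$. $C_0(\mathbb R;X)$ is the space of continuous functions $\mathbb R\to X$ vanishing at infinity, with sup norm. The evolution semigroup of an evolution family $U$ is the $C_0$-semigroup $(\mathcal T(t)f)(s)=U(s,s-t)f(s-t)$ on $C_0(\mathbb R;X)$. The multiplication operator $A(\cdot)$ on $C_0(\mathbb R;X)$ has domain $D(A(\cdot))=\{f\in C_0(\mathbb R;X): f(s)\in D(A(s))\ \forall s,\ [s\mapsto A(s)f(s)]\in C_0(\mathbb R;X)\}$ and $(A(\cdot)f)(s)=A(s)f(s)$; likewise $B(\cdot)$. The operator $-\frac{d}{ds}$ has domain $\{f\in C^1(\mathbb R;X): f,f'\in C_0(\mathbb R;X)\}$, and $\mathcal C$ has domain $D(-\frac{d}{ds})\cap D(A(\cdot))\cap D(B(\cdot))$. *)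

theory Defs
  imports "HOL-Analysis.Analysis"
begin

section \<open>Unbounded linear operators\<close>

text \<open>Only the values of \<open>op_app A\<close> on \<open>op_dom A\<close> are meaningful; two operators are compared through
  their graphs.\<close>

datatype 'a operator = Operator (op_dom: "'a set") (op_app: "'a \<Rightarrow> 'a")

definition op_graph :: "'a operator \<Rightarrow> ('a \<times> 'a) set" where
  "op_graph A = {(x, op_app A x) | x. x \<in> op_dom A}"

definition linear_operator :: "'a::real_vector operator \<Rightarrow> bool" where
  "linear_operator A \<longleftrightarrow>
     subspace (op_dom A) \<and>
     (\<forall>x\<in>op_dom A. \<forall>y\<in>op_dom A. op_app A (x + y) = op_app A x + op_app A y) \<and>
     (\<forall>c. \<forall>x\<in>op_dom A. op_app A (c *\<^sub>R x) = c *\<^sub>R op_app A x)"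

definition op_sum :: "'a::plus operator \<Rightarrow> 'a operator \<Rightarrow> 'a operator" where
  "op_sum A B = Operator (op_dom A \<inter> op_dom B) (\<lambda>x. op_app A x + op_app B x)"

definition resolvent :: "real \<Rightarrow> 'a::real_vector operator \<Rightarrow> 'a \<Rightarrow> 'a" where
  "resolvent \<mu> A = inv_into (op_dom A) (\<lambda>y. \<mu> *\<^sub>R y - op_app A y)"

definition closable :: "'a::topological_space operator \<Rightarrow> bool" where
  "closable A \<longleftrightarrow> single_valued (closure (op_graph A))"

text \<open>Meaningful for closable operators, where the graph of the closure is the closure of the graph.\<close>

definition op_closure :: "'a::topological_space operator \<Rightarrow> 'a operator" where
  "op_closure A = Operator (Domain (closure (op_graph A)))
     (\<lambda>x. THE y. (x, y) \<in> closure (op_graph A))"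

lemma op_graph_op_closure: "closable A \<Longrightarrow> op_graph (op_closure A) = closure (op_graph A)"
proof -
  assume c: "closable A"
  have the: "(THE y. (x, y) \<in> closure (op_graph A)) = y" if "(x, y) \<in> closure (op_graph A)" for x y
    using c that by (intro the_equality) (auto simp: closable_def single_valued_def)
  show ?thesis
    unfolding op_graph_def[of "op_closure A"] by (auto simp: op_closure_def the)
qed


section \<open>Strongly continuous semigroups\<close>

text \<open>Semigroups are indexed by \<open>real\<close>; only the values at \<open>t \<ge> 0\<close> matter.\<close>

definition C0_semigroup :: "(real \<Rightarrow> 'a::real_normed_vector \<Rightarrow>\<^sub>L 'a) \<Rightarrow> bool" where
  "C0_semigroup T \<longleftrightarrow>
     T 0 = id_blinfun \<and>
     (\<forall>s\<ge>0. \<forall>t\<ge>0. T (s + t) = T s o\<^sub>L T t) \<and>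
     (\<forall>x. continuous_on {0..} (\<lambda>t. T t x))"

definition generator :: "(real \<Rightarrow> 'a::real_normed_vector \<Rightarrow>\<^sub>L 'a) \<Rightarrow> 'a operator" where
  "generator T = Operator
     {x. \<exists>y. ((\<lambda>h. (T h x - x) /\<^sub>R h) \<longlongrightarrow> y) (at_right 0)}
     (\<lambda>x. Lim (at_right 0) (\<lambda>h. (T h x - x) /\<^sub>R h))"

definition generates ::
  "'a::real_normed_vector operator \<Rightarrow> (real \<Rightarrow> 'a \<Rightarrow>\<^sub>L 'a) \<Rightarrow> bool" where
  "generates A T \<longleftrightarrow> C0_semigroup T \<and> op_graph (generator T) = op_graph A"


section \<open>Ordered products\<close>

text \<open>\<open>oprod_dec U n\<close> is \<open>U (n-1) \<cdots> U 1 U 0\<close> and \<open>oprod_inc U n\<close> is \<open>U 0 U 1 \<cdots> U (n-1)\<close>.\<close>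

primrec oprod_dec ::
  "(nat \<Rightarrow> 'a::real_normed_vector \<Rightarrow>\<^sub>L 'a) \<Rightarrow> nat \<Rightarrow> 'a \<Rightarrow>\<^sub>L 'a" where
  "oprod_dec U 0 = id_blinfun"
| "oprod_dec U (Suc n) = U n o\<^sub>L oprod_dec U n"

primrec oprod_inc ::
  "(nat \<Rightarrow> 'a::real_normed_vector \<Rightarrow>\<^sub>L 'a) \<Rightarrow> nat \<Rightarrow> 'a \<Rightarrow>\<^sub>L 'a" where
  "oprod_inc U 0 = id_blinfun"
| "oprod_inc U (Suc n) = oprod_inc U n o\<^sub>L U n"


section \<open>Non-autonomous Cauchy problems and evolution families\<close>

text \<open>A solution is a total function of which only the restriction to \<open>{s..}\<close> matters; the derivative
  at \<open>s\<close> is one-sided.\<close>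

definition classical_solution ::
  "(real \<Rightarrow> 'a::real_normed_vector operator) \<Rightarrow> real \<Rightarrow> 'a \<Rightarrow> (real \<Rightarrow> 'a) \<Rightarrow> bool" where
  "classical_solution G s x u \<longleftrightarrow>
     (\<exists>u'. continuous_on {s..} u' \<and>
        (\<forall>t\<ge>s. (u has_vector_derivative u' t) (at t within {s..}) \<and>
                u t \<in> op_dom (G t) \<and> u' t = op_app (G t) (u t))) \<and>
     u s = x"

definition ncp_space :: "(real \<Rightarrow> 'a::real_normed_vector operator) \<Rightarrow> real \<Rightarrow> 'a set" where
  "ncp_space G s = {y. \<exists>u. classical_solution G s y u}"

definition ncp_sol ::
  "(real \<Rightarrow> 'a::real_normed_vector operator) \<Rightarrow> real \<Rightarrow> 'a \<Rightarrow> real \<Rightarrow> 'a" where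
  "ncp_sol G s y = (SOME u. classical_solution G s y u)"

definition ncp_sol_ext ::
  "(real \<Rightarrow> 'a::real_normed_vector operator) \<Rightarrow> real \<Rightarrow> 'a \<Rightarrow> real \<Rightarrow> 'a" where
  "ncp_sol_ext G r y t = (if t \<ge> r then ncp_sol G r y t else y)"

definition well_posed :: "(real \<Rightarrow> 'a::real_normed_vector operator) \<Rightarrow> bool" where
  "well_posed G \<longleftrightarrow>
     (\<forall>s. closure (ncp_space G s) = UNIV \<and> ncp_space G s \<subseteq> op_dom (G s)) \<and>
     (\<forall>s y u v. classical_solution G s y u \<longrightarrow> classical_solution G s y v \<longrightarrow>
        (\<forall>t\<ge>s. u t = v t)) \<and>
     (\<forall>sn s yn y. sn \<longlonglongrightarrow> s \<longrightarrow> yn \<longlonglongrightarrow> y \<longrightarrow>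
        (\<forall>n. yn n \<in> ncp_space G (sn n)) \<longrightarrow> y \<in> ncp_space G s \<longrightarrow>
        (\<forall>K. compact K \<longrightarrow>
           uniform_limit K (\<lambda>n. ncp_sol_ext G (sn n) (yn n)) (ncp_sol_ext G s y) sequentially)) \<and>
     (\<exists>M\<ge>1. \<exists>\<omega>. \<forall>s. \<forall>y\<in>ncp_space G s. \<forall>t\<ge>s.
        norm (ncp_sol G s y t) \<le> M * exp (\<omega> * (t - s)) * norm y)"

definition evolution_family :: "(real \<Rightarrow> real \<Rightarrow> 'a::real_normed_vector \<Rightarrow>\<^sub>L 'a) \<Rightarrow> bool" where
  "evolution_family U \<longleftrightarrow>
     (\<forall>s r t. s \<le> r \<longrightarrow> r \<le> t \<longrightarrow> U t r o\<^sub>L U r s = U t s) \<and>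
     (\<forall>t. U t t = id_blinfun) \<and>
     (\<forall>x. continuous_on {(t, s). s \<le> t} (\<lambda>(t, s). U t s x)) \<and>
     (\<exists>M\<ge>1. \<exists>\<omega>. \<forall>s t. s \<le> t \<longrightarrow> norm (U t s) \<le> M * exp (\<omega> * (t - s)))"

definition solves_ncp ::
  "(real \<Rightarrow> real \<Rightarrow> 'a::real_normed_vector \<Rightarrow>\<^sub>L 'a) \<Rightarrow> (real \<Rightarrow> 'a operator) \<Rightarrow> bool" where
  "solves_ncp U G \<longleftrightarrow> (\<forall>s. closure {y. classical_solution G s y (\<lambda>t. U t s y)} = UNIV)"


section \<open>The Banach space $C_0(R;X)$\<close>

definition c0_funs :: "(real \<Rightarrow> 'a::real_normed_vector) set" where
  "c0_funs = {f. continuous_on UNIV f \<and> (f \<longlongrightarrow> 0) at_infinity}"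

typedef (overloaded) 'a c0fun = "c0_funs :: (real \<Rightarrow> 'a::real_normed_vector) set"
  morphisms c0_apply Abs_c0fun
  by (rule exI[of _ "\<lambda>_. 0"]) (simp add: c0_funs_def)

setup_lifting type_definition_c0fun

lemma c0fun_eqI: "(\<And>s. c0_apply f s = c0_apply g s) \<Longrightarrow> f = g"
  by (simp add: c0_apply_inject[symmetric] fun_eq_iff)

lemma continuous_c0_apply: "continuous_on UNIV (c0_apply f)"
  using c0_apply[of f] by (simp add: c0_funs_def)

lemma tendsto_c0_apply: "(c0_apply f \<longlongrightarrow> 0) at_infinity"
  using c0_apply[of f] by (simp add: c0_funs_def)

lemma bounded_c0_apply: "bounded (range (c0_apply f))"
proof -
  have "eventually (\<lambda>s. dist (c0_apply f s) 0 < 1) at_infinity"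
    using tendsto_c0_apply[of f] by (rule tendstoD) simp
  then obtain b where b: "\<And>s. b \<le> norm s \<Longrightarrow> norm (c0_apply f s) < 1"
    unfolding eventually_at_infinity by auto
  have "compact (c0_apply f ` cball 0 b)"
    by (rule compact_continuous_image) (auto intro: continuous_on_subset[OF continuous_c0_apply])
  then have "bounded (c0_apply f ` cball 0 b)"
    by (rule compact_imp_bounded)
  then obtain c where c: "\<And>s. norm s \<le> b \<Longrightarrow> norm (c0_apply f s) \<le> c"
    unfolding bounded_iff by (metis image_eqI mem_cball_0)
  have "norm (c0_apply f s) \<le> max 1 c" for s
    using b[of s] c[of s] by (cases "norm s \<le> b") auto
  then show ?thesis
    unfolding bounded_iff by auto
qed

lemma bdd_above_c0_apply: "bdd_above (range (\<lambda>s. norm (c0_apply f s)))"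
  using bounded_c0_apply[of f] unfolding bounded_iff bdd_above_def by auto

instantiation c0fun :: (real_normed_vector) real_normed_vector
begin

lift_definition zero_c0fun :: "'a c0fun" is "\<lambda>_. 0"
  by (simp add: c0_funs_def)

lift_definition plus_c0fun :: "'a c0fun \<Rightarrow> 'a c0fun \<Rightarrow> 'a c0fun" is "\<lambda>f g s. f s + g s"
  unfolding c0_funs_def by (auto intro!: continuous_intros tendsto_add_zero)

lift_definition uminus_c0fun :: "'a c0fun \<Rightarrow> 'a c0fun" is "\<lambda>f s. - f s"
  unfolding c0_funs_def by (auto intro!: continuous_intros tendsto_eq_intros)

lift_definition minus_c0fun :: "'a c0fun \<Rightarrow> 'a c0fun \<Rightarrow> 'a c0fun" is "\<lambda>f g s. f s - g s"
  unfolding c0_funs_def by (auto intro!: continuous_intros tendsto_eq_intros)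

lift_definition scaleR_c0fun :: "real \<Rightarrow> 'a c0fun \<Rightarrow> 'a c0fun" is "\<lambda>c f s. c *\<^sub>R f s"
  unfolding c0_funs_def
  by (auto intro!: continuous_intros tendsto_eq_intros)

definition norm_c0fun :: "'a c0fun \<Rightarrow> real" where
  "norm_c0fun f = (SUP s. norm (c0_apply f s))"

definition dist_c0fun :: "'a c0fun \<Rightarrow> 'a c0fun \<Rightarrow> real" where
  "dist_c0fun f g = norm (f - g)"

definition sgn_c0fun :: "'a c0fun \<Rightarrow> 'a c0fun" where
  "sgn_c0fun f = inverse (norm f) *\<^sub>R f"

definition uniformity_c0fun :: "('a c0fun \<times> 'a c0fun) filter" where
  "uniformity_c0fun = (INF e\<in>{0<..}. principal {(f, g). dist f g < e})"

definition open_c0fun :: "'a c0fun set \<Rightarrow> bool" where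
  "open_c0fun S \<longleftrightarrow> (\<forall>f\<in>S. \<forall>\<^sub>F (f', g) in uniformity. f' = f \<longrightarrow> g \<in> S)"

instance
proof
  fix f g h :: "'a c0fun" and a b :: real
  have le: "norm (c0_apply k s) \<le> norm k" for k :: "'a c0fun" and s
    unfolding norm_c0fun_def by (rule cSUP_upper[OF UNIV_I bdd_above_c0_apply])
  have bound: "norm k \<le> c" if "\<And>s. norm (c0_apply k s) \<le> c" for k :: "'a c0fun" and c
    unfolding norm_c0fun_def by (rule cSUP_least) (use that in auto)
  show "f + g + h = f + (g + h)" by transfer (simp add: algebra_simps)
  show "f + g = g + f" by transfer (simp add: algebra_simps)
  show "0 + f = f" by transfer simp
  show "- f + f = 0" by transfer simp
  show "f - g = f + - g" by transfer simp
  show "a *\<^sub>R (f + g) = a *\<^sub>R f + a *\<^sub>R g" by transfer (simp add: algebra_simps)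
  show "(a + b) *\<^sub>R f = a *\<^sub>R f + b *\<^sub>R f" by transfer (simp add: algebra_simps)
  show "a *\<^sub>R b *\<^sub>R f = (a * b) *\<^sub>R f" by transfer simp
  show "1 *\<^sub>R f = f" by transfer simp
  show "dist f g = norm (f - g)" by (rule dist_c0fun_def)
  show "sgn f = inverse (norm f) *\<^sub>R f" by (rule sgn_c0fun_def)
  show "uniformity = (INF e\<in>{0<..}. principal {(f :: 'a c0fun, g). dist f g < e})"
    by (rule uniformity_c0fun_def)
  show "open S \<longleftrightarrow> (\<forall>f\<in>S. \<forall>\<^sub>F (f', g) in uniformity. f' = f \<longrightarrow> g \<in> S)" for S :: "'a c0fun set"
    by (rule open_c0fun_def)
  show "norm f = 0 \<longleftrightarrow> f = 0"
  proof
    assume "norm f = 0"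
    then have "c0_apply f s = 0" for s using le[of f s] by simp
    then show "f = 0" by (intro c0fun_eqI) (simp add: zero_c0fun.rep_eq)
  next
    assume "f = 0"
    then show "norm f = 0" by (simp add: norm_c0fun_def zero_c0fun.rep_eq)
  qed
  show "norm (f + g) \<le> norm f + norm g"
    by (rule bound) (simp add: plus_c0fun.rep_eq norm_triangle_le add_mono le)
  have sc: "norm (c *\<^sub>R k) \<le> \<bar>c\<bar> * norm k" for c and k :: "'a c0fun"
    by (rule bound) (simp add: scaleR_c0fun.rep_eq mult_left_mono le)
  show "norm (a *\<^sub>R f) = \<bar>a\<bar> * norm f"
  proof (cases "a = 0")
    case True
    then have "a *\<^sub>R f = 0" by transfer simp
    then show ?thesis using True by (simp add: norm_c0fun_def zero_c0fun.rep_eq)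
  next
    case False
    have "inverse a *\<^sub>R a *\<^sub>R f = f" using False by transfer simp
    then have "norm f \<le> \<bar>inverse a\<bar> * norm (a *\<^sub>R f)" using sc[of "inverse a" "a *\<^sub>R f"] by simp
    then have "\<bar>a\<bar> * norm f \<le> norm (a *\<^sub>R f)" using False by (simp add: field_simps)
    then show ?thesis using sc[of a f] by simp
  qed
qed

end

lemma norm_c0_apply_le: "norm (c0_apply f s) \<le> norm f"
  unfolding norm_c0fun_def by (rule cSUP_upper[OF UNIV_I bdd_above_c0_apply])

lemma norm_c0fun_le: "(\<And>s. norm (c0_apply f s) \<le> c) \<Longrightarrow> norm f \<le> c"
  unfolding norm_c0fun_def by (rule cSUP_least) auto

lemma c0_funs_uniform_limit:
  assumes f: "\<And>n. f n \<in> c0_funs" and lim: "uniform_limit UNIV f g sequentially"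
  shows "g \<in> c0_funs"
proof -
  have "continuous_on UNIV g"
    by (rule uniform_limit_theorem[OF _ lim]) (use f in \<open>auto simp: c0_funs_def\<close>)
  moreover have "(g \<longlongrightarrow> 0) at_infinity"
  proof (rule tendstoI)
    fix e :: real assume e: "e > 0"
    from uniform_limitD[OF lim, of "e / 2"] e
    obtain n where n: "\<And>s. dist (f n s) (g s) < e / 2"
      by (auto simp: eventually_sequentially)
    have "(f n \<longlongrightarrow> 0) at_infinity" using f[of n] by (simp add: c0_funs_def)
    then have "\<forall>\<^sub>F s in at_infinity. dist (f n s) 0 < e / 2"
      by (rule tendstoD) (use e in simp)
    then show "\<forall>\<^sub>F s in at_infinity. dist (g s) 0 < e"
    proof (rule eventually_mono)
      fix s assume "dist (f n s) 0 < e / 2"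
      then show "dist (g s) 0 < e" using n[of s] by (metis dist_commute dist_triangle_half_r)
    qed
  qed
  ultimately show ?thesis by (simp add: c0_funs_def)
qed

instance c0fun :: (banach) banach
proof
  fix X :: "nat \<Rightarrow> 'a c0fun"
  assume X: "Cauchy X"
  have d: "dist (c0_apply f s) (c0_apply g s) \<le> dist f g" for f g :: "'a c0fun" and s
    using norm_c0_apply_le[of "f - g" s] by (simp add: dist_norm minus_c0fun.rep_eq)
  have "uniformly_convergent_on UNIV (\<lambda>n. c0_apply (X n))"
  proof (rule Cauchy_uniformly_convergent, unfold uniformly_Cauchy_on_def, intro allI impI)
    fix e :: real assume "e > 0"
    with X obtain N where "\<And>m n. m \<ge> N \<Longrightarrow> n \<ge> N \<Longrightarrow> dist (X m) (X n) < e"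
      unfolding Cauchy_def by blast
    then show "\<exists>N. \<forall>s\<in>UNIV. \<forall>m\<ge>N. \<forall>n\<ge>N. dist (c0_apply (X m) s) (c0_apply (X n) s) < e"
      by (meson d le_less_trans)
  qed
  then obtain g where g: "uniform_limit UNIV (\<lambda>n. c0_apply (X n)) g sequentially"
    unfolding uniformly_convergent_on_def by blast
  have "g \<in> c0_funs" by (rule c0_funs_uniform_limit[OF c0_apply g])
  then have ga: "c0_apply (Abs_c0fun g) = g" by (rule Abs_c0fun_inverse)
  have "X \<longlonglongrightarrow> Abs_c0fun g"
  proof (rule tendstoI)
    fix e :: real assume e: "e > 0"
    have "\<forall>\<^sub>F n in sequentially. \<forall>s\<in>UNIV. dist (c0_apply (X n) s) (g s) < e / 2"
      by (rule uniform_limitD[OF g]) (use e in simp)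
    then show "\<forall>\<^sub>F n in sequentially. dist (X n) (Abs_c0fun g) < e"
    proof (rule eventually_mono)
      fix n assume *: "\<forall>s\<in>UNIV. dist (c0_apply (X n) s) (g s) < e / 2"
      have "norm (X n - Abs_c0fun g) \<le> e / 2"
        by (rule norm_c0fun_le) (use * in \<open>auto simp: minus_c0fun.rep_eq ga dist_norm less_imp_le\<close>)
      then show "dist (X n) (Abs_c0fun g) < e" using e by (simp add: dist_norm)
    qed
  qed
  then show "convergent X" by (auto simp: convergent_def)
qed


section \<open>Operators and the evolution semigroup on $C_0(R;X)$\<close>

definition mult_operator ::
  "(real \<Rightarrow> 'a::real_normed_vector operator) \<Rightarrow> 'a c0fun operator" where
  "mult_operator A = Operator
     {f. (\<forall>s. c0_apply f s \<in> op_dom (A s)) \<and> (\<lambda>s. op_app (A s) (c0_apply f s)) \<in> c0_funs}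
     (\<lambda>f. Abs_c0fun (\<lambda>s. op_app (A s) (c0_apply f s)))"

definition neg_deriv :: "'a::real_normed_vector c0fun operator" where
  "neg_deriv = Operator
     {f. (\<forall>s. c0_apply f differentiable (at s)) \<and>
         (\<lambda>s. vector_derivative (c0_apply f) (at s)) \<in> c0_funs}
     (\<lambda>f. - Abs_c0fun (\<lambda>s. vector_derivative (c0_apply f) (at s)))"

text \<open>The defining formula lies in \<open>c0_funs\<close> and is bounded linear in \<open>f\<close> only for \<open>t \<ge> 0\<close> and an
  exponentially bounded evolution family; see \<open>evolution_semigroup_apply\<close>.\<close>

definition evolution_semigroup ::
  "(real \<Rightarrow> real \<Rightarrow> 'a::real_normed_vector \<Rightarrow>\<^sub>L 'a) \<Rightarrow> real \<Rightarrow> 'a c0fun \<Rightarrow>\<^sub>L 'a c0fun" where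
  "evolution_semigroup U t =
     Blinfun (\<lambda>f. Abs_c0fun (\<lambda>s. U s (s - t) (c0_apply f (s - t))))"

lemma evolution_semigroup_in_c0_funs:
  assumes U: "evolution_family U" and t: "t \<ge> 0"
  shows "(\<lambda>s. U s (s - t) (c0_apply f (s - t))) \<in> c0_funs"
proof -
  from U obtain M \<omega> where M: "\<And>s t. s \<le> t \<Longrightarrow> norm (U t s) \<le> M * exp (\<omega> * (t - s))"
    unfolding evolution_family_def by blast
  have K: "norm (U s (s - t)) \<le> M * exp (\<omega> * t)" for s
    using M[of "s - t" s] t by simp
  let ?K = "M * exp (\<omega> * t)"
  have Ux: "norm (U s (s - t) x) \<le> ?K * norm x" for s x
    using norm_blinfun[of "U s (s - t)" x] mult_right_mono[OF K[of s], of "norm x"] by simp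
  have fc: "isCont (\<lambda>s. c0_apply f (s - t)) s" for s
    by (rule continuous_on_interior[of UNIV])
      (auto intro!: continuous_on_compose2[OF continuous_c0_apply] continuous_intros)
  have "isCont (\<lambda>s. U s (s - t) (c0_apply f (s - t))) s0" for s0
  proof -
    let ?y = "c0_apply f (s0 - t)"
    have "continuous_on UNIV (\<lambda>s. (\<lambda>(t, s). U t s ?y) (s, s - t))"
      by (rule continuous_on_compose2[where t = "{(t, s). s \<le> t}"])
        (use U t in \<open>auto simp: evolution_family_def intro!: continuous_intros\<close>)
    then have "isCont (\<lambda>s. U s (s - t) ?y) s0"
      by (simp add: continuous_on_eq_continuous_at)
    then have 1: "((\<lambda>s. U s (s - t) ?y) \<longlongrightarrow> U s0 (s0 - t) ?y) (at s0)"
      by (simp add: isCont_def)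
    have "((\<lambda>s. c0_apply f (s - t) - ?y) \<longlongrightarrow> 0) (at s0)"
      using fc[of s0] by (auto simp: isCont_def intro: LIM_zero)
    then have "((\<lambda>s. ?K * norm (c0_apply f (s - t) - ?y)) \<longlongrightarrow> 0) (at s0)"
      by (intro tendsto_mult_right_zero tendsto_norm_zero)
    then have "((\<lambda>s. U s (s - t) (c0_apply f (s - t) - ?y)) \<longlongrightarrow> 0) (at s0)"
      by (rule Lim_null_comparison[OF always_eventually, rotated]) (use Ux in blast)
    from tendsto_add[OF this 1] show ?thesis
      by (simp add: isCont_def blinfun.diff_right)
  qed
  then have "continuous_on UNIV (\<lambda>s. U s (s - t) (c0_apply f (s - t)))"
    by (simp add: continuous_on_eq_continuous_at)
  moreover have "((\<lambda>s. U s (s - t) (c0_apply f (s - t))) \<longlongrightarrow> 0) at_infinity"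
  proof -
    have "filterlim (\<lambda>s::real. s - t) at_infinity at_infinity"
      using tendsto_add_filterlim_at_infinity'[OF filterlim_ident tendsto_const, of "- t"] by simp
    then have "((\<lambda>s. c0_apply f (s - t)) \<longlongrightarrow> 0) at_infinity"
      by (rule filterlim_compose[OF tendsto_c0_apply])
    then have "((\<lambda>s. ?K * norm (c0_apply f (s - t))) \<longlongrightarrow> 0) at_infinity"
      by (intro tendsto_mult_right_zero tendsto_norm_zero)
    then show ?thesis
      by (rule Lim_null_comparison[OF always_eventually, rotated]) (use Ux in blast)
  qed
  ultimately show ?thesis by (simp add: c0_funs_def)
qed

lemma evolution_semigroup_apply:
  assumes U: "evolution_family U" and t: "t \<ge> 0"
  shows "c0_apply (evolution_semigroup U t f) s = U s (s - t) (c0_apply f (s - t))"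
proof -
  define F where "F = (\<lambda>f. Abs_c0fun (\<lambda>s. U s (s - t) (c0_apply f (s - t))))"
  have F_apply: "c0_apply (F f) = (\<lambda>s. U s (s - t) (c0_apply f (s - t)))" for f
    unfolding F_def by (rule Abs_c0fun_inverse[OF evolution_semigroup_in_c0_funs[OF U t]])
  from U obtain M \<omega> where M: "M \<ge> 1" "\<And>s t. s \<le> t \<Longrightarrow> norm (U t s) \<le> M * exp (\<omega> * (t - s))"
    unfolding evolution_family_def by blast
  have "bounded_linear F"
  proof (rule bounded_linear_intro[where K = "M * exp (\<omega> * t)"])
    show "F (f + g) = F f + F g" for f g
      by (rule c0fun_eqI) (simp add: F_apply plus_c0fun.rep_eq blinfun.add_right)
    show "F (c *\<^sub>R f) = c *\<^sub>R F f" for c f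
      by (rule c0fun_eqI) (simp add: F_apply scaleR_c0fun.rep_eq blinfun.scaleR_right)
    show "norm (F f) \<le> norm f * (M * exp (\<omega> * t))" for f
    proof (rule norm_c0fun_le)
      fix s
      have "norm (c0_apply (F f) s) \<le> norm (U s (s - t)) * norm (c0_apply f (s - t))"
        by (simp add: F_apply norm_blinfun)
      also have "\<dots> \<le> (M * exp (\<omega> * t)) * norm f"
        using M(2)[of "s - t" s] t M(1) by (intro mult_mono norm_c0_apply_le) auto
      finally show "norm (c0_apply (F f) s) \<le> norm f * (M * exp (\<omega> * t))"
        by (simp add: mult.commute)
    qed
  qed
  then show ?thesis
    by (simp add: evolution_semigroup_def F_def[symmetric] bounded_linear_Blinfun_apply F_apply)
qed

end

theory Submission
  imports Defs "HOL-Probability.Discrete_Topology"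
begin

text \<open>
  On functions of \<open>s\<close> put \<open>(F h \<phi>) s = V (s - h) h (\<phi> (s - h))\<close>, where \<open>V r h\<close> is the splitting step
  with frozen time \<open>r\<close>. Then \<open>(F (t / n) ^ n \<phi>) s\<close> is the ordered product of the statement applied to
  \<open>\<phi> (s - t)\<close>, the stability hypothesis bounds the powers of \<open>F h\<close>, and \<open>(F h f - f) / h\<close> converges
  uniformly to \<open>- f' + A(\<cdot>) f + B(\<cdot>) f\<close> for \<open>f\<close> in the core of the generator \<open>G\<close> of the evolution
  semigroup \<open>T\<close>. Chernoff's product formula gives the claim.

  The operators \<open>F h\<close> act on all bounded functions, so that continuity of \<open>r \<mapsto> exp (h A(r)) x\<close>
  (the Trotter--Kato theorem) is never needed; \<open>T\<close> acts on the subspace of functions vanishing at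
  infinity. Chernoff's formula is proved without exponentials of \<open>A\<^sub>h = (F h - 1) / h\<close>: its resolvent
  \<open>R\<^sub>h\<close> at a fixed point converges strongly to that of \<open>G\<close>, because \<open>A\<^sub>h\<close> converges on a core, and
  telescoping \<open>F h ^ (n - k) R\<^sub>h (T (k h) v)\<close> over \<open>k\<close> controls \<open>F h ^ n w - T (n h) w\<close> for \<open>w\<close>
  in the domain of \<open>G\<^sup>2\<close>, where \<open>v = (\<lambda> - G) w\<close>.
\<close>

section \<open>Strongly continuous semigroups and their generators\<close>

text \<open>Also applied to families that are not semigroups, where it is a one-sided derivative at \<open>0\<close>.\<close>

definition in_generator ::
  "(real \<Rightarrow> 'a::real_normed_vector \<Rightarrow>\<^sub>L 'a) \<Rightarrow> 'a \<Rightarrow> 'a \<Rightarrow> bool" where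
  "in_generator S x y \<longleftrightarrow> ((\<lambda>h. (S h x - x) /\<^sub>R h) \<longlongrightarrow> y) (at_right 0)"

lemma in_generator_unique: "in_generator S x y \<Longrightarrow> in_generator S x z \<Longrightarrow> y = z"
  unfolding in_generator_def by (rule tendsto_unique[rotated]) auto

lemma op_graph_generator: "(x, y) \<in> op_graph (generator S) \<longleftrightarrow> in_generator S x y"
proof -
  have "Lim (at_right 0) (\<lambda>h. (S h x - x) /\<^sub>R h) = z" if "in_generator S x z" for z
    using that unfolding in_generator_def by (intro tendsto_Lim) auto
  then show ?thesis
    unfolding op_graph_def generator_def in_generator_def by auto
qed

lemma generates_in_generator:
  "generates A S \<Longrightarrow> in_generator S x y \<longleftrightarrow> x \<in> op_dom A \<and> y = op_app A x"
  unfolding op_graph_generator[symmetric] generates_def by (auto simp: op_graph_def)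

lemma in_generator_scaleR:
  assumes "in_generator S x y" shows "in_generator S (c *\<^sub>R x) (c *\<^sub>R y)"
proof -
  have "(\<lambda>h. (S h (c *\<^sub>R x) - c *\<^sub>R x) /\<^sub>R h) = (\<lambda>h. c *\<^sub>R ((S h x - x) /\<^sub>R h))"
    by (simp add: fun_eq_iff blinfun.scaleR_right scaleR_diff_right[symmetric])
  then show ?thesis
    using tendsto_scaleR[OF tendsto_const assms[unfolded in_generator_def]]
    unfolding in_generator_def by simp
qed

lemma in_generator_diff:
  assumes "in_generator S x y" "in_generator S x' y'" shows "in_generator S (x - x') (y - y')"
proof -
  have "(\<lambda>h. (S h (x - x') - (x - x')) /\<^sub>R h) = (\<lambda>h. (S h x - x) /\<^sub>R h - (S h x' - x') /\<^sub>R h)"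
    by (simp add: fun_eq_iff blinfun.diff_right algebra_simps)
  then show ?thesis
    using assms unfolding in_generator_def by (auto intro!: tendsto_intros)
qed

text \<open>At the left end point of \<open>{t..b}\<close> the filter
  \<open>at t within {t..b}\<close> is \<open>at_right t\<close>; shifting it to 0 turns the
  derivative of an integral into the limit that \<open>in_generator\<close> speaks of.\<close>

lemma tendsto_right_difference_quotient:
  fixes f :: "real \<Rightarrow> 'a::real_normed_vector"
  assumes f: "(f has_vector_derivative f') (at t within {t..b})" and "t < b"
  shows "((\<lambda>h. (f (t + h) - f t) /\<^sub>R h) \<longlongrightarrow> f') (at_right 0)"
proof -
  have "at t within {t..b} = at_right t"
    using \<open>t < b\<close> by (rule at_within_Icc_at_right)
  then have "((\<lambda>y. norm (f y - f t - (y - t) *\<^sub>R f') / norm (y - t)) \<longlongrightarrow> 0) (at_right t)"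
    using f unfolding has_vector_derivative_def has_derivative_iff_norm by simp
  then have "((\<lambda>h. norm (f (t + h) - f t - h *\<^sub>R f') / norm h) \<longlongrightarrow> 0) (at_right 0)"
    by (subst (asm) at_right_to_0) (simp add: filterlim_filtermap add.commute)
  then have "((\<lambda>h. norm ((f (t + h) - f t) /\<^sub>R h - f')) \<longlongrightarrow> 0) (at_right 0)"
  proof (rule Lim_transform_eventually)
    show "\<forall>\<^sub>F h in at_right 0. norm (f (t + h) - f t - h *\<^sub>R f') / norm h
        = norm ((f (t + h) - f t) /\<^sub>R h - f')"
    proof (rule eventually_mono[OF eventually_at_right_less])
      fix h :: real assume "0 < h"
      then have "(f (t + h) - f t) /\<^sub>R h - f' = (f (t + h) - f t - h *\<^sub>R f') /\<^sub>R h"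
        by (simp add: scaleR_diff_right)
      then show "norm (f (t + h) - f t - h *\<^sub>R f') / norm h
        = norm ((f (t + h) - f t) /\<^sub>R h - f')"
        using \<open>0 < h\<close> by (simp add: divide_inverse_commute)
    qed
  qed
  then show ?thesis
    by (simp add: tendsto_norm_zero_iff LIM_zero_cancel)
qed

text \<open>\<open>M\<close> and \<open>\<omega>\<close> are parameters because all semigroups of a
  family must later share one bound.\<close>

locale bounded_C0_semigroup =
  fixes S :: "real \<Rightarrow> 'a::banach \<Rightarrow>\<^sub>L 'a" and M \<omega> :: real
  assumes C0: "C0_semigroup S"
    and bound: "\<And>t. t \<ge> 0 \<Longrightarrow> norm (S t) \<le> M * exp (\<omega> * t)"
begin

lemma S_0 [simp]: "S 0 x = x"
  using C0 by (simp add: C0_semigroup_def)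

lemma S_add: "s \<ge> 0 \<Longrightarrow> t \<ge> 0 \<Longrightarrow> S (s + t) x = S s (S t x)"
  using C0 by (simp add: C0_semigroup_def)

lemma S_commute: "s \<ge> 0 \<Longrightarrow> t \<ge> 0 \<Longrightarrow> S s (S t x) = S t (S s x)"
  by (metis S_add add.commute)

lemma S_continuous: "T \<subseteq> {0..} \<Longrightarrow> continuous_on T (\<lambda>t. S t x)"
  using C0 continuous_on_subset unfolding C0_semigroup_def by blast

text \<open>The absolute value makes the exponential nondecreasing whatever the sign of
  \<open>\<omega>\<close>, so one constant serves for the whole interval
  \<open>{0..b}\<close>.\<close>

lemma norm_S_le:
  assumes "0 \<le> t" "t \<le> b" shows "norm (S t x) \<le> (M * exp (\<bar>\<omega>\<bar> * b)) * norm x"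
proof -
  have "0 \<le> M * exp (\<omega> * 0)"
    using bound[of 0] norm_ge_zero order_trans by blast
  then have "0 \<le> M" by simp
  moreover have "\<omega> * t \<le> \<bar>\<omega>\<bar> * b"
    using assms by (meson abs_ge_self abs_ge_zero mult_mono order_trans)
  ultimately have "norm (S t) \<le> M * exp (\<bar>\<omega>\<bar> * b)"
    using bound[of t] \<open>0 \<le> t\<close> by (smt (verit) exp_le_cancel_iff mult_left_mono)
  then show ?thesis
    using norm_blinfun[of "S t" x] by (meson mult_right_mono norm_ge_zero order_trans)
qed

section \<open>Primitives of orbits\<close>

definition prim :: "'a \<Rightarrow> real \<Rightarrow> 'a" where
  "prim x t = integral {0..t} (\<lambda>\<tau>. S \<tau> x)"

lemma prim_0 [simp]: "prim x 0 = 0"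
  by (simp add: prim_def)

lemma S_integrable: "(\<lambda>\<tau>. S \<tau> x) integrable_on {0..t}"
  by (rule integrable_continuous_interval) (rule S_continuous, auto)

lemma prim_has_vector_derivative:
  "t \<in> {0..b} \<Longrightarrow> (prim x has_vector_derivative S t x) (at t within {0..b})"
  unfolding prim_def by (rule integral_has_vector_derivative) (auto intro: S_continuous)

lemma prim_right_quotient:
  assumes "t \<ge> 0"
  shows "((\<lambda>h. (prim x (t + h) - prim x t) /\<^sub>R h) \<longlongrightarrow> S t x) (at_right 0)"
proof (rule tendsto_right_difference_quotient)
  show "(prim x has_vector_derivative S t x) (at t within {t..t+1})"
    using assms by (intro has_vector_derivative_within_subset[OF prim_has_vector_derivative[where b = "t+1"]]) auto
qed simp

lemma prim_average: "((\<lambda>h. prim x h /\<^sub>R h) \<longlongrightarrow> x) (at_right 0)"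
  using prim_right_quotient[of 0 x] by simp

text \<open>Applying \<open>S h\<close> under the integral shifts the orbit by \<open>h\<close>, so
  that the integral runs from \<open>h\<close> to \<open>t + h\<close>.\<close>

lemma S_prim:
  assumes "t \<ge> 0" "h \<ge> 0"
  shows "S h (prim x t) = prim x (t + h) - prim x h"
proof -
  have "S h (prim x t) = integral {0..t} (\<lambda>\<tau>. S h (S \<tau> x))"
    unfolding prim_def
    using integral_linear[OF S_integrable blinfun.bounded_linear_right[of "S h"], of t x]
    by (simp add: o_def)
  also have "\<dots> = integral {0..t} (\<lambda>\<tau>. S (h + \<tau>) x)"
    using assms by (intro integral_cong) (simp add: S_add)
  \<comment> \<open>The change of variables is done through an antiderivative of the integrand, the
    shifted primitive.\<close>
  also have "((\<lambda>\<tau>. S (h + \<tau>) x) has_integral (prim x (h + t) - prim x (h + 0))) {0..t}"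
  proof (rule fundamental_theorem_of_calculus)
    fix \<tau> assume "\<tau> \<in> {0..t}"
    have "((prim x \<circ> (+) h) has_vector_derivative 1 *\<^sub>R S (h + \<tau>) x) (at \<tau> within {0..t})"
    proof (rule vector_diff_chain_within)
      show "((+) h has_vector_derivative 1) (at \<tau> within {0..t})"
        by (auto intro!: derivative_eq_intros)
      show "(prim x has_vector_derivative S (h + \<tau>) x) (at (h + \<tau>) within (+) h ` {0..t})"
        using assms \<open>\<tau> \<in> {0..t}\<close>
        by (intro has_vector_derivative_within_subset[OF prim_has_vector_derivative[where b = "h+t"]])
          auto
    qed
    then show "((\<lambda>\<tau>. prim x (h + \<tau>)) has_vector_derivative S (h + \<tau>) x) (at \<tau> within {0..t})"
      by (simp add: o_def)
  qed (use assms in simp)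
  then have "integral {0..t} (\<lambda>\<tau>. S (h + \<tau>) x) = prim x (h + t) - prim x h"
    by (simp add: integral_unique)
  finally show ?thesis by (simp add: add.commute)
qed

text \<open>By \<open>S_prim\<close> the difference quotient is the mean of the orbit over
  \<open>{t..t+h}\<close> minus that over \<open>{0..h}\<close>; these tend to \<open>S t x\<close>
  and \<open>x\<close>.\<close>

lemma in_generator_prim:
  assumes "t \<ge> 0" shows "in_generator S (prim x t) (S t x - x)"
  unfolding in_generator_def
proof (rule Lim_transform_eventually)
  show "((\<lambda>h. (prim x (t + h) - prim x t) /\<^sub>R h - prim x h /\<^sub>R h) \<longlongrightarrow> S t x - x) (at_right 0)"
    by (intro tendsto_diff prim_average prim_right_quotient assms)
  show "\<forall>\<^sub>F h in at_right 0. (prim x (t + h) - prim x t) /\<^sub>R h - prim x h /\<^sub>R h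
      = (S h (prim x t) - prim x t) /\<^sub>R h"
    by (rule eventually_mono[OF eventually_at_right_less])
      (simp add: S_prim assms algebra_simps)
qed

lemma in_generator_S:
  assumes "in_generator S x y" "t \<ge> 0"
  shows "in_generator S (S t x) (S t y)"
  unfolding in_generator_def
proof (rule Lim_transform_eventually)
  show "((\<lambda>h. S t ((S h x - x) /\<^sub>R h)) \<longlongrightarrow> S t y) (at_right 0)"
    using assms(1) unfolding in_generator_def by (intro tendsto_intros)
  show "\<forall>\<^sub>F h in at_right 0. S t ((S h x - x) /\<^sub>R h) = (S h (S t x) - S t x) /\<^sub>R h"
    by (rule eventually_mono[OF eventually_at_right_less])
      (simp add: blinfun.scaleR_right blinfun.diff_right S_commute[OF _ assms(2)])
qed

lemma prim_diff: "prim (x - y) t = prim x t - prim y t"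
  unfolding prim_def blinfun.diff_right by (intro integral_diff S_integrable)

lemma prim_scaleR: "prim (c *\<^sub>R x) t = c *\<^sub>R prim x t"
  unfolding prim_def blinfun.scaleR_right by simp

lemma norm_prim_le:
  assumes "t \<ge> 0" shows "norm (prim x t) \<le> t * ((M * exp (\<bar>\<omega>\<bar> * t)) * norm x)"
proof -
  have "norm (integral {0..t} (\<lambda>\<tau>. S \<tau> x)) \<le> ((M * exp (\<bar>\<omega>\<bar> * t)) * norm x) * (t - 0)"
    using assms by (intro integral_bound S_continuous) (auto intro: norm_S_le)
  then show ?thesis by (simp add: prim_def mult.commute)
qed

text \<open>The generator is evaluated at \<open>prim x t\<close> in two ways:
  \<open>in_generator_prim\<close> gives \<open>S t x - x\<close>, and pulling the difference
  quotient under the integral gives \<open>prim y t\<close>. This avoids a two-sided derivative of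
  the orbit.\<close>

lemma in_generator_imp_prim:
  assumes xy: "in_generator S x y" and t: "t \<ge> 0"
  shows "S t x - x = prim y t"
proof -
  have "in_generator S (prim x t) (prim y t)"
    unfolding in_generator_def
  proof (rule Lim_transform_eventually)
    have "((\<lambda>h. prim ((S h x - x) /\<^sub>R h - y) t) \<longlongrightarrow> 0) (at_right 0)"
    proof (rule Lim_null_comparison[OF always_eventually])
      show "\<forall>h. norm (prim ((S h x - x) /\<^sub>R h - y) t)
          \<le> t * ((M * exp (\<bar>\<omega>\<bar> * t)) * norm ((S h x - x) /\<^sub>R h - y))"
        using norm_prim_le[OF t] by blast
      show "((\<lambda>h. t * ((M * exp (\<bar>\<omega>\<bar> * t)) * norm ((S h x - x) /\<^sub>R h - y))) \<longlongrightarrow> 0) (at_right 0)"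
        using xy unfolding in_generator_def
        by (intro tendsto_mult_right_zero tendsto_norm_zero LIM_zero)
    qed
    then show "((\<lambda>h. prim ((S h x - x) /\<^sub>R h) t) \<longlongrightarrow> prim y t) (at_right 0)"
      unfolding prim_diff by (rule LIM_zero_cancel)
    have "prim (S h x) t = S h (prim x t)" if "h > 0" for h
    proof -
      have "prim (S h x) t = integral {0..t} (\<lambda>\<tau>. S h (S \<tau> x))"
        unfolding prim_def using that by (intro integral_cong) (auto intro: S_commute)
      also have "\<dots> = S h (prim x t)"
        unfolding prim_def
        using integral_linear[OF S_integrable blinfun.bounded_linear_right[of "S h"], of t x]
        by (simp add: o_def)
      finally show ?thesis .
    qed
    then show "\<forall>\<^sub>F h in at_right 0. prim ((S h x - x) /\<^sub>R h) t
        = (S h (prim x t) - prim x t) /\<^sub>R h"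
      by (intro eventually_mono[OF eventually_at_right_less]) (simp add: prim_scaleR prim_diff)
  qed
  then show ?thesis
    using in_generator_prim[OF t, of x] in_generator_unique by blast
qed

text \<open>The error is the integral of \<open>S \<tau> y - y\<close>. So the orbit of
  \<open>y\<close> alone controls how fast the difference quotient converges, which later gives
  uniformity over a family of semigroups.\<close>

lemma norm_generator_error_le:
  assumes xy: "in_generator S x y" and t: "t \<ge> 0"
    and c: "\<And>\<tau>. 0 \<le> \<tau> \<Longrightarrow> \<tau> \<le> t \<Longrightarrow> norm (S \<tau> y - y) \<le> c"
  shows "norm (S t x - x - t *\<^sub>R y) \<le> t * c"
proof -
  have "S t x - x - t *\<^sub>R y = integral {0..t} (\<lambda>\<tau>. S \<tau> y - y)"
    using t integral_diff[OF S_integrable[of y t] integrable_const_ivl[of y 0 t]]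
    by (simp add: in_generator_imp_prim[OF xy t] prim_def)
  also have "norm \<dots> \<le> c * (t - 0)"
    using t c by (intro integral_bound continuous_intros S_continuous) auto
  finally show ?thesis by (simp add: mult.commute)
qed

lemma norm_S_diff_le:
  assumes xy: "in_generator S x y" and t: "t \<ge> 0"
  shows "norm (S t x - x) \<le> t * ((M * exp (\<bar>\<omega>\<bar> * t)) * norm y)"
  unfolding in_generator_imp_prim[OF xy t] by (rule norm_prim_le[OF t])

text \<open>The means of the orbit over \<open>{0..h}\<close> lie in the domain and tend to
  \<open>x\<close> as \<open>h\<close> tends to 0.\<close>

lemma generator_dense:
  assumes "e > 0"
  obtains y z where "in_generator S y z" "norm (y - x) < e"
proof -
  have "\<forall>\<^sub>F h in at_right 0. dist (prim x h /\<^sub>R h) x < e \<and> 0 < h"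
    using tendstoD[OF prim_average assms] by (rule eventually_conj) (rule eventually_at_right_less)
  then obtain h where h: "dist (prim x h /\<^sub>R h) x < e" "0 < h"
    by (metis (lifting) eventually_happens trivial_limit_at_right_real)
  show thesis
    using that[OF in_generator_scaleR[OF in_generator_prim[of h x]], of "inverse h"] h
    by (simp add: dist_norm)
qed

text \<open>For \<open>x'\<close> in the domain, taking the mean of its orbit gains one more degree:
  the generator maps this mean to \<open>(S h x' - x') /\<^sub>R h\<close>, which is again in the
  domain.\<close>

lemma generator_square_dense:
  assumes "e > 0"
  obtains w y z where "in_generator S w y" "in_generator S y z" "norm (w - x) < e"
proof -
  obtain x' y' where x': "in_generator S x' y'" "norm (x' - x) < e / 2"
    using generator_dense[of "e / 2" x] assms by auto
  have "\<forall>\<^sub>F h in at_right 0. dist (prim x' h /\<^sub>R h) x' < e / 2 \<and> 0 < h"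
    using assms
    by (intro eventually_conj tendstoD[OF prim_average] eventually_at_right_less) simp
  then obtain h where h: "dist (prim x' h /\<^sub>R h) x' < e / 2" "0 < h"
    by (metis (lifting) eventually_happens trivial_limit_at_right_real)
  have "norm (prim x' h /\<^sub>R h - x) < e"
    using h x'(2) norm_triangle_ineq[of "prim x' h /\<^sub>R h - x'" "x' - x"] by (simp add: dist_norm)
  moreover have "in_generator S ((S h x' - x') /\<^sub>R h) ((S h y' - y') /\<^sub>R h)"
    using h x' by (intro in_generator_scaleR in_generator_diff in_generator_S) auto
  moreover have "in_generator S (prim x' h /\<^sub>R h) ((S h x' - x') /\<^sub>R h)"
    using h by (intro in_generator_scaleR in_generator_prim) auto
  ultimately show thesis using that by blast
qed

section \<open>Rescaled semigroups and resolvents\<close>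

lemma rescaled:
  "bounded_C0_semigroup (\<lambda>t. exp (- \<mu> * t) *\<^sub>R S t) M (\<omega> - \<mu>)"
proof
  have "exp (- \<mu> * (s + t)) *\<^sub>R S (s + t) = (exp (- \<mu> * s) *\<^sub>R S s) o\<^sub>L (exp (- \<mu> * t) *\<^sub>R S t)"
    if "s \<ge> 0" "t \<ge> 0" for s t
    using that by (intro blinfun_eqI)
      (simp add: S_add blinfun.scaleR_left blinfun.scaleR_right exp_add[symmetric] algebra_simps)
  then show "C0_semigroup (\<lambda>t. exp (- \<mu> * t) *\<^sub>R S t)"
    using C0 unfolding C0_semigroup_def
    by (auto simp: blinfun.scaleR_left intro!: continuous_on_scaleR continuous_on_exp
        continuous_on_minus continuous_on_mult_left continuous_on_id)
  show "norm (exp (- \<mu> * t) *\<^sub>R S t) \<le> M * exp ((\<omega> - \<mu>) * t)" if "t \<ge> 0" for t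
  proof -
    have "exp (- \<mu> * t) * norm (S t) \<le> exp (- \<mu> * t) * (M * exp (\<omega> * t))"
      by (intro mult_left_mono bound that) simp
    also have "\<dots> = M * (exp (- \<mu> * t) * exp (\<omega> * t))" by simp
    also have "exp (- \<mu> * t) * exp (\<omega> * t) = exp ((\<omega> - \<mu>) * t)"
      by (simp add: exp_add[symmetric] algebra_simps)
    finally show ?thesis by simp
  qed
qed

lemma in_generator_rescaled:
  "in_generator (\<lambda>t. exp (- \<mu> * t) *\<^sub>R S t) x (y - \<mu> *\<^sub>R x) \<longleftrightarrow> in_generator S x y" (is "?l = ?r")
proof -
  have e: "((\<lambda>h. (exp (c * h) - 1) / h) \<longlongrightarrow> c) (at_right 0)" for c :: real
  proof -
    have "((\<lambda>h. exp (c * h)) has_field_derivative c) (at 0)"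
      by (auto intro!: derivative_eq_intros)
    then have "((\<lambda>h. (exp (c * h) - 1) / h) \<longlongrightarrow> c) (at 0)"
      by (simp add: has_field_derivative_iff)
    then show ?thesis by (rule tendsto_within_subset) auto
  qed
  have ex: "((\<lambda>h. exp (c * h)) \<longlongrightarrow> 1) (at_right 0)" for c :: real
    by (auto intro!: tendsto_eq_intros)
  \<comment> \<open>One product rule, for an arbitrary family \<open>T\<close>, serves both
    implications: once for \<open>S\<close> and once, with the opposite exponent, for the rescaled
    semigroup.\<close>
  have key: "((\<lambda>h. (exp (c * h) *\<^sub>R T h x - x) /\<^sub>R h) \<longlongrightarrow> z + c *\<^sub>R x) (at_right 0)"
    if "in_generator T x z" for T c z
  proof -
    have "((\<lambda>h. exp (c * h) *\<^sub>R ((T h x - x) /\<^sub>R h) + ((exp (c * h) - 1) / h) *\<^sub>R x)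
        \<longlongrightarrow> 1 *\<^sub>R z + c *\<^sub>R x) (at_right 0)"
      using that unfolding in_generator_def by (intro tendsto_intros e ex)
    moreover have "exp (c * h) *\<^sub>R ((T h x - x) /\<^sub>R h) + ((exp (c * h) - 1) / h) *\<^sub>R x
        = (exp (c * h) *\<^sub>R T h x - x) /\<^sub>R h" for h
      by (simp add: algebra_simps divide_inverse)
    ultimately show ?thesis by simp
  qed
  show ?thesis
  proof
    assume ?l
    from key[OF this, of \<mu>] show ?r
      by (simp add: in_generator_def blinfun.scaleR_left exp_add[symmetric])
  next
    assume ?r
    from key[OF this, of "- \<mu>"] show ?l
      by (simp add: in_generator_def blinfun.scaleR_left)
  qed
qed

text \<open>A fixed point replaces the Laplace transform. The rescaled semigroup \<open>S'\<close>
  is a strict contraction at some time \<open>T\<close>. If \<open>x = z + S' T x\<close>, its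
  generator maps \<open>S'.prim x T\<close> to \<open>S' T x - x = - z\<close>. An element of the
  kernel of that generator is fixed by \<open>S' T\<close>, hence is 0.\<close>

lemma resolvent_bijective:
  assumes "\<mu> > \<omega>"
  shows "\<exists>!x. in_generator S x (\<mu> *\<^sub>R x - z)"
proof -
  define S' where "S' = (\<lambda>t. exp (- \<mu> * t) *\<^sub>R S t)"
  interpret S': bounded_C0_semigroup S' M "\<omega> - \<mu>"
    unfolding S'_def by (rule rescaled)
  have gen: "in_generator S' x (- z) \<longleftrightarrow> in_generator S x (\<mu> *\<^sub>R x - z)" for x z
    using in_generator_rescaled[of \<mu> x "\<mu> *\<^sub>R x - z"] by (simp add: S'_def)
  have "((\<lambda>t. M * exp ((\<omega> - \<mu>) * t)) \<longlongrightarrow> M * 0) at_top"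
    using assms
    by (intro tendsto_intros filterlim_compose[OF exp_at_bot] filterlim_tendsto_neg_mult_at_bot)
      (auto intro: filterlim_ident)
  then have "\<forall>\<^sub>F t in at_top. M * exp ((\<omega> - \<mu>) * t) < 1 / 2 \<and> 0 \<le> t"
    by (intro eventually_conj eventually_ge_at_top order_tendstoD(2)[where a = "1/2"]) auto
  then obtain T where T: "M * exp ((\<omega> - \<mu>) * T) < 1 / 2" "0 \<le> T"
    by (metis (lifting) eventually_happens trivial_limit_at_top_linorder)
  have half: "norm (S' T x) \<le> 1 / 2 * norm x" for x
    using S'.bound[OF T(2)] T(1) norm_blinfun[of "S' T" x]
    by (smt (verit) mult_right_mono norm_ge_zero)
  show ?thesis
  proof (rule ex_ex1I)
    have "\<exists>!x. z + S' T x = x"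
      by (rule banach_fix_type[where c = "1/2"])
        (use half in \<open>auto simp: dist_norm blinfun.diff_right[symmetric]\<close>)
    then obtain x where x: "z + S' T x = x" by blast
    then have "S' T x - x = - z" by (simp add: algebra_simps)
    then show "\<exists>x. in_generator S x (\<mu> *\<^sub>R x - z)"
      using S'.in_generator_prim[OF T(2), of x] gen by auto
  next
    fix x y assume "in_generator S x (\<mu> *\<^sub>R x - z)" "in_generator S y (\<mu> *\<^sub>R y - z)"
    then have "in_generator S' (x - y) (- z - (- z))"
      by (intro in_generator_diff) (simp_all add: gen)
    then have "norm (S' T (x - y) - (x - y)) \<le> 0"
      using S'.norm_S_diff_le[OF _ T(2)] by fastforce
    then have "norm (x - y) \<le> 1 / 2 * norm (x - y)"
      using half[of "x - y"] by simp
    then show "x = y" by simp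
  qed
qed

text \<open>\<open>resolvent\<close> is an \<open>inv_into\<close>, so it is bijectivity of
  \<open>\<mu> - A\<close> that gives it meaning; this form lets the continuity of resolvents be
  used through \<open>in_generator\<close>.\<close>

lemma resolvent_eq_iff:
  assumes A: "generates A S" and "\<mu> > \<omega>"
  shows "resolvent \<mu> A z = x \<longleftrightarrow> in_generator S x (\<mu> *\<^sub>R x - z)"
proof -
  have *: "in_generator S x (\<mu> *\<^sub>R x - z) \<longleftrightarrow> x \<in> op_dom A \<and> \<mu> *\<^sub>R x - op_app A x = z" for x z
    by (auto simp: generates_in_generator[OF A] algebra_simps)
  have ex1: "\<exists>!x. x \<in> op_dom A \<and> \<mu> *\<^sub>R x - op_app A x = z" for z
    using resolvent_bijective[OF \<open>\<mu> > \<omega>\<close>, of z] unfolding * .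
  then have "inj_on (\<lambda>y. \<mu> *\<^sub>R y - op_app A y) (op_dom A)"
    by (intro inj_onI) blast
  moreover have "z \<in> (\<lambda>y. \<mu> *\<^sub>R y - op_app A y) ` op_dom A"
    using ex1[of z] by blast
  ultimately show ?thesis
    unfolding * resolvent_def by (metis (mono_tags, lifting) f_inv_into_f inv_into_f_eq inv_into_into)
qed

end


section \<open>Chernoff product formula\<close>

lemma eventually_at_right_le: "d > (0::real) \<Longrightarrow> \<forall>\<^sub>F h in at_right 0. 0 < h \<and> h \<le> d"
  by (intro eventually_conj eventually_at_right_less)
    (auto simp: eventually_at_right_field intro!: exI[of _ d])

lemma oprod_dec_const_Suc: "oprod_dec (\<lambda>_. F) (Suc n) x = oprod_dec (\<lambda>_. F) n (F x)"
  by (induction n arbitrary: x) auto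

text \<open>The Neumann series with terms \<open>P k\<close> over \<open>\<rho> ^ (k + 1)\<close>
  converges by the bound on all powers, even where the norm of \<open>F\<close> itself exceeds
  \<open>\<rho>\<close>.\<close>

lemma power_bounded_resolvent:
  fixes F :: "'e::banach \<Rightarrow>\<^sub>L 'e"
  assumes F: "\<And>k. norm (oprod_dec (\<lambda>_. F) k) \<le> M * q ^ k" and q: "0 \<le> q" "q < \<rho>"
  obtains R :: "'e \<Rightarrow>\<^sub>L 'e" where "\<And>x. R (\<rho> *\<^sub>R x - F x) = x" "\<And>x. \<rho> *\<^sub>R R x - F (R x) = x"
    "norm R \<le> M / (\<rho> - q)"
proof -
  define P where "P = oprod_dec (\<lambda>_. F)"
  define a where "a = (\<lambda>k. (1 / \<rho> ^ Suc k) *\<^sub>R P k)"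
  have \<rho>: "\<rho> > 0" "norm (q / \<rho>) < 1" using q by auto
  have a: "norm (a k) \<le> M / \<rho> * (q / \<rho>) ^ k" for k
    using F[of k] \<rho> by (simp add: a_def P_def power_divide divide_simps)
  have geo: "(\<lambda>k. M / \<rho> * (q / \<rho>) ^ k) sums (M / \<rho> * (1 / (1 - q / \<rho>)))"
    using \<rho>(2) by (intro sums_mult geometric_sums)
  have sn: "summable (\<lambda>k. norm (a k))"
    by (rule summable_comparison_test[OF _ sums_summable[OF geo]]) (use a in auto)
  then have sm: "summable a" by (rule summable_norm_cancel)
  define R where "R = suminf a"
  have R: "a sums R" using sm by (simp add: R_def summable_sums)
  then have tail: "(\<lambda>k. a (Suc k)) sums (R - (1 / \<rho>) *\<^sub>R id_blinfun)"
    using sums_split_initial_segment[OF R, of 1] by (simp add: a_def P_def)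
  \<comment> \<open>Composing a term with \<open>F\<close> on either side gives
    \<open>\<rho>\<close> times the next term, so both products are \<open>\<rho>\<close> times the
    series without its first term.\<close>
  have 1: "F o\<^sub>L a k = \<rho> *\<^sub>R a (Suc k)" for k
    using \<rho> by (intro blinfun_eqI)
      (simp add: a_def P_def blinfun.scaleR_left blinfun.scaleR_right)
  have 2: "a k o\<^sub>L F = \<rho> *\<^sub>R a (Suc k)" for k
    using \<rho> oprod_dec_const_Suc[of F k] by (intro blinfun_eqI)
      (simp add: a_def P_def blinfun.scaleR_left)
  have 3: "\<rho> *\<^sub>R (R - (1 / \<rho>) *\<^sub>R id_blinfun) = \<rho> *\<^sub>R R - id_blinfun"
    using \<rho> by (simp add: scaleR_diff_right)
  have s3: "(\<lambda>k. \<rho> *\<^sub>R a (Suc k)) sums (\<rho> *\<^sub>R R - id_blinfun)"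
    using sums_scaleR_right[OF tail, of \<rho>] unfolding 3 .
  have FR: "F o\<^sub>L R = \<rho> *\<^sub>R R - id_blinfun"
    using bounded_linear.sums[OF bounded_bilinear.bounded_linear_right[OF bounded_bilinear_blinfun_compose] R, of F] s3
    unfolding 1 by (rule sums_unique2)
  have RF: "R o\<^sub>L F = \<rho> *\<^sub>R R - id_blinfun"
    using bounded_linear.sums[OF bounded_bilinear.bounded_linear_left[OF bounded_bilinear_blinfun_compose] R, of F] s3
    unfolding 2 by (rule sums_unique2)
  have res: "R (\<rho> *\<^sub>R x - F x) = x" "\<rho> *\<^sub>R R x - F (R x) = x" for x
    using arg_cong[OF RF, of "\<lambda>G. G x"] arg_cong[OF FR, of "\<lambda>G. G x"]
    by (simp_all add: blinfun.diff_right blinfun.diff_left blinfun.scaleR_right blinfun.scaleR_left)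
  have "norm R \<le> (\<Sum>k. norm (a k))"
    unfolding R_def by (rule summable_norm[OF sn])
  also have "\<dots> \<le> M / \<rho> * (1 / (1 - q / \<rho>))"
    using suminf_le[OF a sn sums_summable[OF geo]] sums_unique[OF geo] by simp
  also have "\<dots> = M / (\<rho> - q)"
    using \<rho> q by (simp add: field_simps)
  finally show thesis by (intro that[OF res])
qed

text \<open>A finite subcover leaves finitely many eventual statements; this turns locally uniform
  smallness into uniform smallness on \<open>K\<close>.\<close>

lemma eventually_ball_compact:
  assumes "compact K"
    and "\<And>\<sigma>. \<sigma> \<in> K \<Longrightarrow> \<exists>U. open U \<and> \<sigma> \<in> U \<and> (\<forall>\<^sub>F h in F. \<forall>\<tau>\<in>U \<inter> K. P h \<tau>)"
  shows "\<forall>\<^sub>F h in F. \<forall>\<tau>\<in>K. P h \<tau>"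
proof -
  obtain U where U: "\<And>\<sigma>. \<sigma> \<in> K \<Longrightarrow> open (U \<sigma>) \<and> \<sigma> \<in> U \<sigma> \<and> (\<forall>\<^sub>F h in F. \<forall>\<tau>\<in>U \<sigma> \<inter> K. P h \<tau>)"
    using assms(2) by metis
  obtain C where C: "C \<subseteq> K" "finite C" "K \<subseteq> (\<Union>\<sigma>\<in>C. U \<sigma>)"
    by (rule compactE_image[OF assms(1), of K U]) (use U in auto)
  have "\<forall>\<^sub>F h in F. \<forall>\<sigma>\<in>C. \<forall>\<tau>\<in>U \<sigma> \<inter> K. P h \<tau>"
    using C U by (intro eventually_ball_finite) auto
  then show ?thesis
    by (rule eventually_mono) (use C in blast)
qed

text \<open>This comes from \<open>1 - x \<le> exp (- x)\<close> with
  \<open>x = \<omega> * h\<close>. The slope does not depend on \<open>h\<close> and fixes the point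
  \<open>lam\<close> below.\<close>

lemma exp_mult_le_one_plus:
  fixes \<omega> h :: real
  assumes "0 \<le> \<omega>" "0 \<le> h" "h \<le> 1"
  shows "exp (\<omega> * h) \<le> 1 + \<omega> * exp \<omega> * h"
proof -
  have "\<omega> * h \<le> \<omega>" using assms by (simp add: mult_left_le)
  have "(1 - \<omega> * h) * exp (\<omega> * h) \<le> exp (- (\<omega> * h)) * exp (\<omega> * h)"
    using exp_ge_add_one_self[of "- (\<omega> * h)"] by (intro mult_right_mono) auto
  then have "exp (\<omega> * h) \<le> 1 + \<omega> * h * exp (\<omega> * h)"
    by (simp add: algebra_simps exp_minus)
  also have "\<dots> \<le> 1 + \<omega> * h * exp \<omega>"
    using assms \<open>\<omega> * h \<le> \<omega>\<close> by (intro add_left_mono mult_left_mono) auto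
  finally show ?thesis by (simp add: algebra_simps)
qed

text \<open>\<open>T\<close> acts on the small space and \<open>F\<close> on the large one, with
  \<open>J\<close> leading from one to the other. \<open>C\<close> is a set of pairs on which
  consistency is known, and its closure contains the graph of the generator.\<close>

locale chernoff = T: bounded_C0_semigroup T M' \<omega>'
  for T :: "real \<Rightarrow> 'c::banach \<Rightarrow>\<^sub>L 'c" and M' \<omega>' :: real +
  fixes J :: "'c \<Rightarrow>\<^sub>L 'e::banach" and F :: "real \<Rightarrow> 'e \<Rightarrow>\<^sub>L 'e" and C :: "('c \<times> 'c) set"
    and M \<omega> :: real
  assumes \<omega>: "\<omega> \<ge> 0"
    and F_0: "F 0 = id_blinfun"
    and stable: "\<And>h n. h > 0 \<Longrightarrow> norm (oprod_dec (\<lambda>_. F h) n) \<le> M * exp (\<omega> * (real n * h))"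
    and consistent: "\<And>f g. (f, g) \<in> C \<Longrightarrow> ((\<lambda>h. (F h (J f) - J f) /\<^sub>R h) \<longlongrightarrow> J g) (at_right 0)"
    and core: "\<And>f g. in_generator T f g \<Longrightarrow> (f, g) \<in> closure C"
begin

text \<open>Chosen so that \<open>exp (\<omega> * h) \<le> 1 + lam * h - h\<close> for
  \<open>0 < h \<le> 1\<close>: the point \<open>1 + lam * h\<close> exceeds the growth factor of
  the powers of \<open>F h\<close> by at least \<open>h\<close>.\<close>

definition lam :: real where "lam = 1 + \<omega> * exp \<omega>"

lemma lam_pos: "lam > 0"
  using \<omega> by (simp add: lam_def add_pos_nonneg)

text \<open>\<open>R\<close> is the resolvent of \<open>(F h - 1) / h\<close> at \<open>lam\<close>.
  The right inverse property is solved for \<open>F h (R x)\<close>, the form that the telescoping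
  sum uses.\<close>

definition is_res :: "real \<Rightarrow> ('e \<Rightarrow>\<^sub>L 'e) \<Rightarrow> bool" where
  "is_res h R \<longleftrightarrow> (\<forall>x. R (lam *\<^sub>R x - (F h x - x) /\<^sub>R h) = x) \<and>
     (\<forall>x. F h (R x) = R x + h *\<^sub>R (lam *\<^sub>R R x - x)) \<and> norm R \<le> M"

text \<open>Meaningful only for \<open>0 < h \<le> 1\<close>; see \<open>res_props\<close>.\<close>

definition res :: "real \<Rightarrow> 'e \<Rightarrow>\<^sub>L 'e" where
  "res h = (SOME R. is_res h R)"

lemma M_nonneg: "M \<ge> 0"
  using order_trans[OF norm_ge_zero stable[of 1 0]] by simp

text \<open>Since \<open>lam - (F h - 1) / h\<close> is \<open>1 / h\<close> times
  \<open>1 + lam * h - F h\<close>, the resolvent is \<open>h\<close> times that of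
  \<open>F h\<close> at \<open>1 + lam * h\<close>. The factor \<open>h\<close> cancels the bound
  \<open>M / h\<close> and leaves a bound independent of \<open>h\<close>.\<close>

lemma res_props:
  assumes h: "0 < h" "h \<le> 1"
  shows "res h (lam *\<^sub>R x - (F h x - x) /\<^sub>R h) = x"
    "F h (res h x) = res h x + h *\<^sub>R (lam *\<^sub>R res h x - x)"
    "norm (res h) \<le> M"
proof -
  have q: "exp (\<omega> * h) \<le> 1 + lam * h - h"
    using exp_mult_le_one_plus[OF \<omega>, of h] h by (simp add: lam_def algebra_simps)
  then have q': "exp (\<omega> * h) < 1 + lam * h" using h by simp
  have st: "norm (oprod_dec (\<lambda>_. F h) k) \<le> M * exp (\<omega> * h) ^ k" for k
    using stable[OF h(1), of k] by (simp add: exp_of_nat_mult[symmetric] algebra_simps)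
  obtain R :: "'e \<Rightarrow>\<^sub>L 'e" where R: "\<And>x. R ((1 + lam * h) *\<^sub>R x - F h x) = x"
    "\<And>x. (1 + lam * h) *\<^sub>R R x - F h (R x) = x" "norm R \<le> M / (1 + lam * h - exp (\<omega> * h))"
    by (rule power_bounded_resolvent[OF st exp_ge_zero q']) blast
  have "M / (1 + lam * h - exp (\<omega> * h)) \<le> M / h"
    using q h M_nonneg by (intro divide_left_mono) auto
  then have "norm R \<le> M / h" using R(3) by simp
  then have "norm (h *\<^sub>R R) \<le> M" using h by (simp add: field_simps)
  moreover have "(h *\<^sub>R R) (lam *\<^sub>R x - (F h x - x) /\<^sub>R h) = x" for x
  proof -
    have "h *\<^sub>R (lam *\<^sub>R x - (F h x - x) /\<^sub>R h) = (1 + lam * h) *\<^sub>R x - F h x"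
      using h by (simp add: algebra_simps)
    then show ?thesis using R(1)[of x] by (simp add: blinfun.scaleR_left blinfun.scaleR_right[symmetric])
  qed
  moreover have "F h ((h *\<^sub>R R) x) = (h *\<^sub>R R) x + h *\<^sub>R (lam *\<^sub>R (h *\<^sub>R R) x - x)" for x
  proof -
    have FR: "F h (R x) = (1 + lam * h) *\<^sub>R R x - x" using R(2)[of x] by (simp add: algebra_simps)
    show ?thesis by (simp add: blinfun.scaleR_left blinfun.scaleR_right FR algebra_simps)
  qed
  ultimately have "is_res h (h *\<^sub>R R)" unfolding is_res_def by blast
  then have "is_res h (res h)" unfolding res_def by (rule someI)
  then show "res h (lam *\<^sub>R x - (F h x - x) /\<^sub>R h) = x"
    "F h (res h x) = res h x + h *\<^sub>R (lam *\<^sub>R res h x - x)" "norm (res h) \<le> M"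
    unfolding is_res_def by auto
qed

lemma norm_res_le: "0 < h \<Longrightarrow> h \<le> 1 \<Longrightarrow> norm (res h x) \<le> M * norm x"
  using norm_blinfun[of "res h" x] mult_right_mono[OF res_props(3)[of h] norm_ge_zero[of x]]
  by linarith

lemma norm_res_J_le: "0 < h \<Longrightarrow> h \<le> 1 \<Longrightarrow> norm (res h (J f)) \<le> M * (norm J * norm f)"
  using norm_res_le[of h "J f"] mult_left_mono[OF norm_blinfun[of J f] M_nonneg] by linarith

text \<open>On a pair of \<open>C\<close> the resolvent inverts \<open>lam - (F h - 1) / h\<close>
  exactly, which leaves only the consistency error; the bound on \<open>res h\<close>, uniform in
  \<open>h\<close>, extends this to the closure of \<open>C\<close>.\<close>

lemma res_tendsto:
  assumes u: "in_generator T u y"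
  shows "((\<lambda>h. res h (J (lam *\<^sub>R u - y))) \<longlongrightarrow> J u) (at_right 0)"
proof (rule tendstoI)
  fix e :: real assume e: "e > 0"
  \<comment> \<open>\<open>K * \<delta>\<close> is the cost of approximating \<open>(u, y)\<close>
    by a pair of \<open>C\<close>, once behind the resolvent and once directly through
    \<open>J\<close>.\<close>
  define K where "K = M * (norm J * (lam + 1)) + norm J"
  have K: "K \<ge> 0" using M_nonneg lam_pos by (auto simp: K_def)
  define \<delta> where "\<delta> = e / 2 / (K + 1)"
  have \<delta>: "\<delta> > 0" using e K by (simp add: \<delta>_def)
  have "K * \<delta> < e / 2"
    using e K by (simp add: \<delta>_def field_simps)
  obtain f g where fg: "(f, g) \<in> C" "dist (f, g) (u, y) < \<delta>"
    using core[OF u] \<delta> unfolding closure_approachable by (metis surj_pair)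
  have f: "norm (f - u) < \<delta>" and g: "norm (g - y) < \<delta>"
    using fg(2) dist_fst_le[of "(f, g)" "(u, y)"] dist_snd_le[of "(f, g)" "(u, y)"]
    by (auto simp: dist_norm)
  have "\<forall>\<^sub>F h in at_right 0. dist ((F h (J f) - J f) /\<^sub>R h) (J g) < e / 2 / (M + 1)"
    using e M_nonneg by (intro tendstoD[OF consistent[OF fg(1)]]) auto
  then show "\<forall>\<^sub>F h in at_right 0. dist (res h (J (lam *\<^sub>R u - y))) (J u) < e"
    using eventually_at_right_le[OF zero_less_one]
  proof eventually_elim
    case (elim h)
    define d where "d = (F h (J f) - J f) /\<^sub>R h - J g"
    have "M * norm d \<le> M * (e / 2 / (M + 1))"
      using elim(1) M_nonneg by (intro mult_left_mono) (auto simp: d_def dist_norm)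
    also have "\<dots> \<le> e / 2"
      using e M_nonneg by (simp add: field_simps)
    finally have d: "norm (res h d) \<le> e / 2"
      using norm_res_le[of h d] elim(2) by simp
    define c where "c = lam *\<^sub>R (u - f) + (g - y)"
    have "norm c \<le> lam * norm (u - f) + norm (g - y)"
      using lam_pos norm_triangle_ineq[of "lam *\<^sub>R (u - f)" "g - y"] by (simp add: c_def)
    also have "\<dots> \<le> lam * \<delta> + \<delta>"
      using f g lam_pos by (intro add_mono mult_left_mono) (auto simp: norm_minus_commute)
    finally have "norm c \<le> (lam + 1) * \<delta>" by (simp add: algebra_simps)
    then have "M * (norm J * norm c) \<le> M * (norm J * ((lam + 1) * \<delta>))"
      using M_nonneg by (intro mult_left_mono) auto
    then have c: "norm (res h (J c)) \<le> M * (norm J * (lam + 1)) * \<delta>"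
      using norm_res_J_le[of h c] elim(2) by (simp add: algebra_simps)
    have fu: "norm (J (f - u)) \<le> norm J * \<delta>"
      using norm_blinfun[of J "f - u"] mult_left_mono[of "norm (f - u)" \<delta> "norm J"] f by simp
    \<comment> \<open>\<open>c\<close> is the approximation error and \<open>d\<close> the
      consistency error; the resolvent sends the bracket to \<open>J f\<close>.\<close>
    have "J (lam *\<^sub>R u - y) = J c + (lam *\<^sub>R J f - (F h (J f) - J f) /\<^sub>R h) + d"
      by (simp add: c_def d_def blinfun.add_right blinfun.diff_right blinfun.scaleR_right algebra_simps)
    then have "res h (J (lam *\<^sub>R u - y)) = res h (J c) + J f + res h d"
      using res_props(1)[of h "J f"] elim(2) by (simp only: blinfun.add_right)
    then have "res h (J (lam *\<^sub>R u - y)) - J u = res h (J c) + J (f - u) + res h d"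
      by (simp add: blinfun.diff_right[of J])
    then have "norm (res h (J (lam *\<^sub>R u - y)) - J u)
        \<le> norm (res h (J c)) + norm (J (f - u)) + norm (res h d)"
      by (metis norm_triangle_ineq norm_triangle_mono order_refl)
    also have "\<dots> \<le> K * \<delta> + e / 2"
      using c fu d by (simp add: K_def algebra_simps)
    also have "\<dots> < e" using \<open>K * \<delta> < e / 2\<close> by simp
    finally show ?case by (simp add: dist_norm)
  qed
qed

text \<open>At a single point of the orbit this is \<open>res_tendsto\<close>. It becomes uniform on
  \<open>{0..t}\<close> because the orbits are continuous and the \<open>res h\<close> uniformly
  bounded.\<close>

lemma res_uniform:
  assumes v: "in_generator T v y" and e: "e > 0"
  shows "\<forall>\<^sub>F h in at_right 0. \<forall>\<tau>\<in>{0..t}.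
    norm (res h (J (T \<tau> (lam *\<^sub>R v - y))) - J (T \<tau> v)) < e"
proof (rule eventually_ball_compact)
  define g where "g = lam *\<^sub>R v - y"
  fix \<sigma> assume \<sigma>: "\<sigma> \<in> {0..t}"
  \<comment> \<open>A bound, independent of \<open>h\<close>, for the change of the error as
    \<open>\<tau>\<close> moves away from \<open>\<sigma>\<close>.\<close>
  define d where "d = (\<lambda>\<tau>. M * (norm J * norm (T \<tau> g - T \<sigma> g)) + norm J * norm (T \<tau> v - T \<sigma> v))"
  have "continuous_on {0..t} d"
    unfolding d_def by (intro continuous_intros T.S_continuous) auto
  then have "((d \<longlongrightarrow> d \<sigma>) (at \<sigma> within {0..t}))"
    using \<sigma> by (simp add: continuous_on)
  moreover have "d \<sigma> = 0" by (simp add: d_def)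
  ultimately have "\<forall>\<^sub>F \<tau> in at \<sigma> within {0..t}. d \<tau> < e / 2"
    using e by (intro order_tendstoD(2)) auto
  then obtain U where U: "open U" "\<sigma> \<in> U" "\<And>\<tau>. \<tau> \<in> U \<Longrightarrow> \<tau> \<in> {0..t} \<Longrightarrow> \<tau> \<noteq> \<sigma> \<Longrightarrow> d \<tau> < e / 2"
    unfolding eventually_at_topological by blast
  have Ud: "d \<tau> < e / 2" if "\<tau> \<in> U \<inter> {0..t}" for \<tau>
    using that U(3)[of \<tau>] \<open>d \<sigma> = 0\<close> e by (cases "\<tau> = \<sigma>") auto
  have "in_generator T (T \<sigma> v) (T \<sigma> y)"
    using v \<sigma> by (intro T.in_generator_S) auto
  from res_tendsto[OF this] have "((\<lambda>h. res h (J (T \<sigma> g))) \<longlongrightarrow> J (T \<sigma> v)) (at_right 0)"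
    by (simp add: g_def blinfun.diff_right[of "T \<sigma>"] blinfun.scaleR_right[of "T \<sigma>"])
  then have "\<forall>\<^sub>F h in at_right 0. dist (res h (J (T \<sigma> g))) (J (T \<sigma> v)) < e / 2"
    using e by (intro tendstoD) auto
  then have "\<forall>\<^sub>F h in at_right 0. \<forall>\<tau>\<in>U \<inter> {0..t}. norm (res h (J (T \<tau> g)) - J (T \<tau> v)) < e"
    using eventually_at_right_le[OF zero_less_one]
  proof eventually_elim
    case (elim h)
    show ?case
    proof
      fix \<tau> assume \<tau>: "\<tau> \<in> U \<inter> {0..t}"
      have "norm (res h (J (T \<tau> g - T \<sigma> g)) - J (T \<tau> v - T \<sigma> v)) \<le> d \<tau>"
        unfolding d_def using elim(2)
        by (intro order_trans[OF norm_triangle_ineq4] add_mono norm_res_J_le norm_blinfun) auto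
      moreover have "res h (J (T \<tau> g)) - J (T \<tau> v)
          = (res h (J (T \<tau> g - T \<sigma> g)) - J (T \<tau> v - T \<sigma> v)) + (res h (J (T \<sigma> g)) - J (T \<sigma> v))"
        by (simp add: blinfun.diff_right)
      ultimately show "norm (res h (J (T \<tau> g)) - J (T \<tau> v)) < e"
        using Ud[OF \<tau>] elim(1) unfolding dist_norm
        by (smt (verit) norm_triangle_ineq field_sum_of_halves)
    qed
  qed
  then show "\<exists>U. open U \<and> \<sigma> \<in> U \<and> (\<forall>\<^sub>F h in at_right 0. \<forall>\<tau>\<in>U \<inter> {0..t}.
      norm (res h (J (T \<tau> (lam *\<^sub>R v - y))) - J (T \<tau> v)) < e)"
    using U unfolding g_def by blast
qed simp

text \<open>Consecutive terms differ by a power of \<open>F h\<close> applied to \<open>h\<close>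
  times two small errors: the resolvent error on the orbit, at most \<open>\<delta>\<close>, and the
  error of the difference quotient of \<open>T\<close> at \<open>v\<close>. There are
  \<open>n\<close> such steps, and \<open>n * h = t\<close>.\<close>

lemma telescoping_estimate:
  assumes h: "0 < h" "h \<le> 1" and t: "real n * h = t"
    and \<delta>: "\<And>\<tau>. \<tau> \<in> {0..t} \<Longrightarrow> norm (res h (J (T \<tau> (lam *\<^sub>R v - y))) - J (T \<tau> v)) \<le> \<delta>"
  shows "norm (res h (J (T t v)) - oprod_dec (\<lambda>_. F h) n (res h (J v)))
    \<le> t * (M * exp (\<omega> * t) *
        (\<delta> + M * (norm J * (M' * exp (\<bar>\<omega>'\<bar> * t) * norm ((T h v - v) /\<^sub>R h - y)))))"
    (is "_ \<le> t * ?B")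
proof -
  define P where "P = oprod_dec (\<lambda>_. F h)"
  define a where "a = (\<lambda>k. P (n - k) (res h (J (T (real k * h) v))))"
  define r where "r = (T h v - v) /\<^sub>R h - y"
  define g where "g = lam *\<^sub>R v - y"
  have step: "norm (a (Suc k) - a k) \<le> h * ?B" if k: "k < n" for k
  proof -
    let ?\<tau> = "real k * h"
    have "(real k + 1) * h \<le> real n * h"
      using k h by (intro mult_right_mono) auto
    then have \<tau>: "0 \<le> ?\<tau>" "?\<tau> \<le> t" using h t by (auto simp: algebra_simps)
    \<comment> \<open>One factor \<open>F h\<close> is split off on the right, next to the
      resolvent, where \<open>res_props\<close> evaluates it.\<close>
    have Pk: "P (n - k) x = P (n - Suc k) (F h x)" for x
      using k oprod_dec_const_Suc[of "F h" "n - Suc k" x] unfolding P_def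
      by (simp only: Suc_diff_Suc)
    have Ts: "T (real (Suc k) * h) v = T ?\<tau> v + h *\<^sub>R T ?\<tau> (y + r)"
    proof -
      have "T (real (Suc k) * h) v = T ?\<tau> (T h v)"
        using T.S_add[of ?\<tau> h v] h by (simp add: algebra_simps)
      also have "T h v = v + h *\<^sub>R (y + r)"
        using h by (simp add: r_def)
      finally show ?thesis by (simp add: blinfun.add_right blinfun.scaleR_right)
    qed
    have Tg: "T ?\<tau> g = lam *\<^sub>R T ?\<tau> v - T ?\<tau> y"
      by (simp add: g_def blinfun.diff_right blinfun.scaleR_right)
    \<comment> \<open>The terms of order 1 cancel; \<open>b\<close> is what remains as the
      coefficient of \<open>h\<close>.\<close>
    define b where "b = res h (J (T ?\<tau> r)) - (res h (J (T ?\<tau> g)) - J (T ?\<tau> v))"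
    have "res h (J (T (real (Suc k) * h) v)) - F h (res h (J (T ?\<tau> v))) = h *\<^sub>R b"
      unfolding Ts res_props(2)[OF h] b_def Tg
      by (simp add: blinfun.add_right blinfun.diff_right blinfun.scaleR_right algebra_simps)
    then have "a (Suc k) - a k = P (n - Suc k) (h *\<^sub>R b)"
      unfolding a_def Pk by (simp add: blinfun.diff_right[symmetric])
    moreover have "norm (P (n - Suc k)) \<le> M * exp (\<omega> * t)"
    proof -
      have "real (n - Suc k) * h \<le> real n * h"
        using h by (intro mult_right_mono) auto
      then have "exp (\<omega> * (real (n - Suc k) * h)) \<le> exp (\<omega> * t)"
        using \<omega> unfolding t by (simp add: mult_left_mono)
      then show ?thesis
        using stable[OF h(1), of "n - Suc k"] M_nonneg unfolding P_def
        by (meson mult_left_mono order_trans)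
    qed
    moreover have "norm b \<le> \<delta> + M * (norm J * (M' * exp (\<bar>\<omega>'\<bar> * t) * norm r))"
    proof -
      have "norm (res h (J (T ?\<tau> r))) \<le> M * (norm J * norm (T ?\<tau> r))"
        using h by (rule norm_res_J_le)
      also have "\<dots> \<le> M * (norm J * (M' * exp (\<bar>\<omega>'\<bar> * t) * norm r))"
        using M_nonneg \<tau> by (intro mult_left_mono T.norm_S_le) auto
      finally show ?thesis
        using \<delta>[of ?\<tau>] \<tau> norm_triangle_ineq4[of "res h (J (T ?\<tau> r))" "res h (J (T ?\<tau> g)) - J (T ?\<tau> v)"]
        unfolding b_def g_def by simp
    qed
    ultimately have "norm (a (Suc k) - a k) \<le> (M * exp (\<omega> * t)) *
        (h * (\<delta> + M * (norm J * (M' * exp (\<bar>\<omega>'\<bar> * t) * norm r))))"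
      using h M_nonneg
      by (auto intro!: order_trans[OF norm_blinfun] mult_mono)
    then show ?thesis by (simp add: r_def algebra_simps)
  qed
  have "a n - a 0 = (\<Sum>k<n. a (Suc k) - a k)"
    by (simp add: sum_lessThan_telescope)
  also have "norm \<dots> \<le> (\<Sum>k<n. h * ?B)"
    by (rule sum_norm_le) (use step in auto)
  also have "\<dots> = t * ?B" using t by (simp flip: t)
  finally show ?thesis
    by (simp add: a_def P_def t)
qed

section \<open>Passage to the limit in Chernoff's formula\<close>

lemma step_filterlim:
  assumes "t > 0" shows "filterlim (\<lambda>n. t / real n) (at_right 0) sequentially"
  unfolding filterlim_at
proof
  show "(\<lambda>n. t / real n) \<longlonglongrightarrow> 0" by (rule lim_const_over_n)
  show "\<forall>\<^sub>F n in sequentially. t / real n \<in> {0<..} \<and> t / real n \<noteq> 0"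
    using assms by (intro eventually_sequentiallyI[of 1]) auto
qed

lemma norm_power_le:
  assumes "t > 0" "n > 0" shows "norm (oprod_dec (\<lambda>_. F (t / real n)) n x) \<le> M * exp (\<omega> * t) * norm x"
proof -
  have "norm (oprod_dec (\<lambda>_. F (t / real n)) n) \<le> M * exp (\<omega> * t)"
    using stable[of "t / real n" n] assms by simp
  then show ?thesis
    using norm_blinfun[of "oprod_dec (\<lambda>_. F (t / real n)) n" x]
    by (meson mult_right_mono norm_ge_zero order_trans)
qed

text \<open>As \<open>z\<close>, the image of \<open>w\<close>, is in the domain too, so is
  \<open>v\<close>, which \<open>res_uniform\<close> and the telescoping estimate require. Since
  \<open>R n (J v)\<close> tends to \<open>J w\<close>, stability allows \<open>J w\<close> to be
  replaced by it.\<close>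

lemma converges_on_generator_square:
  assumes w: "in_generator T w z" and z: "in_generator T z z'" and t: "t > 0"
  shows "(\<lambda>n. oprod_dec (\<lambda>_. F (t / real n)) n (J w)) \<longlonglongrightarrow> J (T t w)"
proof -
  define v where "v = lam *\<^sub>R w - z"
  define y where "y = lam *\<^sub>R z - z'"
  define P where "P = (\<lambda>n. oprod_dec (\<lambda>_. F (t / real n)) n)"
  define R where "R = (\<lambda>n. res (t / real n))"
  have v: "in_generator T v y"
    unfolding v_def y_def by (intro in_generator_diff in_generator_scaleR w z)
  note fl = step_filterlim[OF t]
  \<comment> \<open>The value \<open>n = 0\<close> gives the step \<open>t / 0 = 0\<close>, and
    small \<open>n\<close> may give a step above 1; \<open>res\<close> is meaningful for
    neither.\<close>
  have small: "\<forall>\<^sub>F n in sequentially. 0 < t / real n \<and> t / real n \<le> 1 \<and> n > 0"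
    using eventually_conj[OF fl[unfolded filterlim_iff, rule_format, OF eventually_at_right_le[OF zero_less_one]]
        eventually_gt_at_top[of 0]]
    by simp
  have 1: "(\<lambda>n. R n (J v)) \<longlonglongrightarrow> J w"
    unfolding R_def v_def by (rule filterlim_compose[OF res_tendsto[OF w] fl])
  have "in_generator T (T t w) (T t z)"
    using w t by (intro T.in_generator_S) auto
  from filterlim_compose[OF res_tendsto[OF this] fl]
  have 2: "(\<lambda>n. R n (J (T t v))) \<longlonglongrightarrow> J (T t w)"
    by (simp add: R_def v_def blinfun.diff_right[of "T t"] blinfun.scaleR_right[of "T t"])
  have 3: "(\<lambda>n. R n (J (T t v)) - P n (R n (J v))) \<longlonglongrightarrow> 0"
  proof (rule tendstoI)
    fix e :: real assume e: "e > 0"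
    define c where "c = t * (M * exp (\<omega> * t))"
    have c: "c \<ge> 0" using t M_nonneg by (simp add: c_def)
    define K where "K = M * (norm J * (M' * exp (\<bar>\<omega>'\<bar> * t)))"
    define \<delta> where "\<delta> = e / 2 / (c + 1)"
    have \<delta>: "\<delta> > 0" using e c by (simp add: \<delta>_def)
    have "c * \<delta> < e / 2" using e c by (simp add: \<delta>_def field_simps)
    have "((\<lambda>h. c * (K * norm ((T h v - v) /\<^sub>R h - y))) \<longlongrightarrow> 0) (at_right 0)"
      using v unfolding in_generator_def
      by (intro tendsto_mult_right_zero tendsto_norm_zero LIM_zero)
    then have "\<forall>\<^sub>F h in at_right 0. c * (K * norm ((T h v - v) /\<^sub>R h - y)) < e / 2"
      using e by (intro order_tendstoD(2)) auto
    then have "\<forall>\<^sub>F h in at_right 0. c * (K * norm ((T h v - v) /\<^sub>R h - y)) < e / 2 \<and>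
        (\<forall>\<tau>\<in>{0..t}. norm (res h (J (T \<tau> (lam *\<^sub>R v - y))) - J (T \<tau> v)) < \<delta>)"
      by (intro eventually_conj res_uniform[OF v \<delta>])
    then have "\<forall>\<^sub>F n in sequentially.
        c * (K * norm ((T (t / real n) v - v) /\<^sub>R (t / real n) - y)) < e / 2 \<and>
        (\<forall>\<tau>\<in>{0..t}. norm (R n (J (T \<tau> (lam *\<^sub>R v - y))) - J (T \<tau> v)) < \<delta>)"
      using fl unfolding R_def filterlim_iff by blast
    then show "\<forall>\<^sub>F n in sequentially. dist (R n (J (T t v)) - P n (R n (J v))) 0 < e"
      using small
    proof eventually_elim
      case (elim n)
      have "norm (R n (J (T t v)) - P n (R n (J v)))
          \<le> c * \<delta> + c * (K * norm ((T (t / real n) v - v) /\<^sub>R (t / real n) - y))"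
        using telescoping_estimate[of "t / real n" n t v y \<delta>] elim \<delta>
        unfolding R_def P_def c_def K_def by (simp add: less_imp_le algebra_simps)
      then show ?case using elim \<open>c * \<delta> < e / 2\<close> by simp
    qed
  qed
  have 4: "(\<lambda>n. P n (J w - R n (J v))) \<longlonglongrightarrow> 0"
  proof (rule Lim_null_comparison)
    show "\<forall>\<^sub>F n in sequentially. norm (P n (J w - R n (J v)))
        \<le> M * exp (\<omega> * t) * norm (J w - R n (J v))"
      using eventually_gt_at_top[of 0] by eventually_elim (simp add: P_def norm_power_le[OF t])
    have "(\<lambda>n. J w - R n (J v)) \<longlonglongrightarrow> 0"
      using tendsto_diff[OF tendsto_const 1, of "J w"] by simp
    then show "(\<lambda>n. M * exp (\<omega> * t) * norm (J w - R n (J v))) \<longlonglongrightarrow> 0"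
      by (intro tendsto_mult_right_zero tendsto_norm_zero)
  qed
  \<comment> \<open>The terms with \<open>R n\<close> cancel, so this sum is
    \<open>P n (J w)\<close>.\<close>
  have "(\<lambda>n. P n (J w - R n (J v)) - (R n (J (T t v)) - P n (R n (J v))) + R n (J (T t v)))
      \<longlonglongrightarrow> 0 - 0 + J (T t w)"
    by (intro tendsto_add tendsto_diff 2 3 4)
  then show ?thesis
    by (simp add: P_def blinfun.diff_right)
qed

text \<open>The errors from replacing \<open>f\<close> by \<open>w\<close> are at most
  \<open>K * norm (f - w)\<close> for every \<open>n > 0\<close>, and such \<open>w\<close> are
  dense. The case \<open>t = 0\<close> is separate because stability speaks of positive
  steps.\<close>

theorem product_formula:
  assumes t: "t \<ge> 0"
  shows "(\<lambda>n. oprod_dec (\<lambda>_. F (t / real n)) n (J f)) \<longlonglongrightarrow> J (T t f)"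
proof (cases "t = 0")
  case True
  have "oprod_dec (\<lambda>_. F 0) n x = x" for n x
    by (induction n) (auto simp: F_0)
  then show ?thesis using True by simp
next
  case False
  then have t: "t > 0" using t by simp
  show ?thesis
  proof (rule tendstoI)
    fix e :: real assume e: "e > 0"
    define K where "K = M * exp (\<omega> * t) * norm J + norm J * norm (T t)"
    have K: "K \<ge> 0" using M_nonneg by (simp add: K_def)
    define \<delta> where "\<delta> = e / 2 / (K + 1)"
    have \<delta>: "\<delta> > 0" using e K by (simp add: \<delta>_def)
    have K\<delta>: "K * \<delta> < e / 2" using e K by (simp add: \<delta>_def field_simps)
    obtain w z z' where w: "in_generator T w z" "in_generator T z z'" "norm (w - f) < \<delta>"
      using T.generator_square_dense[OF \<delta>] by blast
    have "\<forall>\<^sub>F n in sequentially. dist (oprod_dec (\<lambda>_. F (t / real n)) n (J w)) (J (T t w)) < e / 2"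
      using e by (intro tendstoD[OF converges_on_generator_square[OF w(1,2) t]]) auto
    then show "\<forall>\<^sub>F n in sequentially. dist (oprod_dec (\<lambda>_. F (t / real n)) n (J f)) (J (T t f)) < e"
      using eventually_gt_at_top[of 0]
    proof eventually_elim
      case (elim n)
      define P where "P = oprod_dec (\<lambda>_. F (t / real n)) n"
      have "norm (P (J (f - w))) \<le> M * exp (\<omega> * t) * (norm J * norm (f - w))"
        unfolding P_def using M_nonneg
        by (intro order_trans[OF norm_power_le[OF t elim(2)]] mult_left_mono norm_blinfun) auto
      moreover have "norm (J (T t (f - w))) \<le> norm J * (norm (T t) * norm (f - w))"
        by (intro order_trans[OF norm_blinfun] mult_left_mono norm_blinfun) auto
      ultimately have "norm (P (J (f - w))) + norm (J (T t (f - w))) \<le> K * norm (f - w)"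
        by (simp add: K_def algebra_simps)
      also have "\<dots> \<le> K * \<delta>"
        using K w(3) by (intro mult_left_mono) (auto simp: norm_minus_commute)
      finally have "norm (P (J (f - w)) - J (T t (f - w))) < e / 2"
        using K\<delta> norm_triangle_ineq4[of "P (J (f - w))" "J (T t (f - w))"] by linarith
      moreover have "P (J f) - J (T t f) = (P (J (f - w)) - J (T t (f - w))) + (P (J w) - J (T t w))"
        by (simp add: blinfun.diff_right)
      ultimately show ?case
        using elim(1) norm_triangle_ineq[of "P (J (f - w)) - J (T t (f - w))" "P (J w) - J (T t w)"]
        by (simp add: dist_norm P_def)
    qed
  qed
qed

end


section \<open>Families of operators near the identity\<close>

lemma tendsto_blinfun_apply_bounded:
  fixes P :: "real \<Rightarrow> 'e::real_normed_vector \<Rightarrow>\<^sub>L 'e"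
  assumes P: "\<forall>\<^sub>F h in F. norm (P h) \<le> K" and u: "(u \<longlongrightarrow> l) F"
    and l: "((\<lambda>h. P h l) \<longlongrightarrow> l') F"
  shows "((\<lambda>h. P h (u h)) \<longlongrightarrow> l') F"
proof -
  have "((\<lambda>h. P h (u h - l)) \<longlongrightarrow> 0) F"
  proof (rule Lim_null_comparison)
    show "\<forall>\<^sub>F h in F. norm (P h (u h - l)) \<le> K * norm (u h - l)"
      using P by eventually_elim
        (meson mult_right_mono norm_blinfun norm_ge_zero order_trans)
    show "((\<lambda>h. K * norm (u h - l)) \<longlongrightarrow> 0) F"
      using u by (intro tendsto_mult_right_zero tendsto_norm_zero LIM_zero)
  qed
  from tendsto_add[OF this l] show ?thesis by (simp add: blinfun.diff_right)
qed

text \<open>Product rule at 0. Convergence of \<open>P h\<close> to the identity is asked for at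
  \<open>b\<close> alone, because translations are not strongly continuous on all bounded
  functions.\<close>

lemma in_generator_compose:
  assumes P: "\<forall>\<^sub>F h in at_right 0. norm (P h) \<le> K"
    and a: "in_generator P u a" and b: "in_generator Q u b"
    and Pb: "((\<lambda>h. P h b) \<longlongrightarrow> b) (at_right 0)"
  shows "in_generator (\<lambda>h. P h o\<^sub>L Q h) u (a + b)"
proof -
  have "((\<lambda>h. P h ((Q h u - u) /\<^sub>R h)) \<longlongrightarrow> b) (at_right 0)"
    by (rule tendsto_blinfun_apply_bounded[OF P b[unfolded in_generator_def] Pb])
  from tendsto_add[OF a[unfolded in_generator_def] this]
  have "((\<lambda>h. (P h u - u) /\<^sub>R h + P h ((Q h u - u) /\<^sub>R h)) \<longlongrightarrow> a + b) (at_right 0)" .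
  moreover have "(P h u - u) /\<^sub>R h + P h ((Q h u - u) /\<^sub>R h) = ((P h o\<^sub>L Q h) u - u) /\<^sub>R h" for h
    by (simp add: blinfun.diff_right blinfun.scaleR_right algebra_simps)
  ultimately show ?thesis
    unfolding in_generator_def by simp
qed

lemma filterlim_half_at_right: "filterlim (\<lambda>h::real. h / 2) (at_right 0) (at_right 0)"
  unfolding filterlim_at
  by (auto intro!: tendsto_eq_intros eventually_at_right_less[THEN eventually_mono])

lemma in_generator_half_step:
  assumes "in_generator P u a"
  shows "in_generator (\<lambda>h. P (h / 2)) u (a /\<^sub>R 2)"
proof -
  from filterlim_compose[OF assms[unfolded in_generator_def] filterlim_half_at_right]
  have "((\<lambda>h. ((P (h / 2) u - u) /\<^sub>R (h / 2)) /\<^sub>R 2) \<longlongrightarrow> a /\<^sub>R 2) (at_right 0)"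
    by (intro tendsto_intros)
  then show ?thesis by (simp add: in_generator_def inverse_eq_divide)
qed

lemma in_generator_average:
  assumes "in_generator P u a" "in_generator Q u b"
  shows "in_generator (\<lambda>h. (1 / 2) *\<^sub>R (P h + Q h)) u ((1 / 2) *\<^sub>R (a + b))"
proof -
  have "((\<lambda>h. (1 / 2) *\<^sub>R ((P h u - u) /\<^sub>R h + (Q h u - u) /\<^sub>R h)) \<longlongrightarrow> (1 / 2) *\<^sub>R (a + b)) (at_right 0)"
    by (intro tendsto_scaleR[OF tendsto_const] tendsto_add assms[unfolded in_generator_def])
  moreover have "(1 / 2) *\<^sub>R ((P h u - u) /\<^sub>R h + (Q h u - u) /\<^sub>R h)
      = (((1 / 2) *\<^sub>R (P h + Q h)) u - u) /\<^sub>R h" for h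
  proof -
    have "(1 / 2) *\<^sub>R (P h u + Q h u) - u = (1 / 2) *\<^sub>R ((P h u - u) + (Q h u - u))"
      by (simp add: algebra_simps flip: scaleR_add_left)
    then show ?thesis
      by (simp add: blinfun.scaleR_left blinfun.add_left scaleR_add_right[symmetric])
  qed
  ultimately show ?thesis by (simp add: in_generator_def)
qed

lemma norm_scaleR_inverse_le:
  fixes v :: "'a::real_normed_vector"
  assumes "norm v \<le> h * e" "h > 0" shows "norm (v /\<^sub>R h) \<le> e"
  using assms by (simp add: field_simps)

section \<open>Bounded functions on the line\<close>

instance bcontfun :: (metric_space, banach) banach ..

text \<open>All functions on a discrete space are continuous, so \<open>real discrete \<Rightarrow>\<^sub>C 'a\<close> is the Banach space of
  all bounded functions.\<close>

abbreviation bval :: "(real discrete \<Rightarrow>\<^sub>C 'a::real_normed_vector) \<Rightarrow> real \<Rightarrow> 'a" where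
  "bval \<phi> s \<equiv> apply_bcontfun \<phi> (discrete s)"

text \<open>Meaningful for bounded \<open>\<phi>\<close>; see \<open>bval_bfun\<close>.\<close>

definition bfun :: "(real \<Rightarrow> 'a::real_normed_vector) \<Rightarrow> real discrete \<Rightarrow>\<^sub>C 'a" where
  "bfun \<phi> = Bcontfun (\<lambda>d. \<phi> (of_discrete d))"

lemma bval_bfun:
  assumes "\<And>s. norm (\<phi> s) \<le> c" shows "bval (bfun \<phi>) s = \<phi> s"
proof -
  have "(\<lambda>d. \<phi> (of_discrete d)) \<in> bcontfun"
    using assms by (intro bcontfun_normI) (auto simp: continuous_on_open_vimage open_discrete)
  then show ?thesis by (simp add: bfun_def Bcontfun_inverse discrete_inverse)
qed

lemma bval_eqI: "(\<And>s. bval \<phi> s = bval \<psi> s) \<Longrightarrow> \<phi> = \<psi>"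
  by (rule bcontfun_eqI) (metis of_discrete_inverse)

lemma norm_bval_bound: "(\<And>s. norm (bval \<phi> s) \<le> c) \<Longrightarrow> norm \<phi> \<le> c"
  by (rule norm_bound) (metis of_discrete_inverse)

lemma tendsto_bvalI:
  assumes "\<And>e. e > 0 \<Longrightarrow> \<forall>\<^sub>F h in F. \<forall>s. norm (bval (\<phi> h) s - bval \<psi> s) \<le> e"
  shows "(\<phi> \<longlongrightarrow> \<psi>) F"
proof (rule tendstoI)
  fix e :: real assume "e > 0"
  then have "\<forall>\<^sub>F h in F. \<forall>s. norm (bval (\<phi> h) s - bval \<psi> s) \<le> e / 2"
    by (intro assms) simp
  then show "\<forall>\<^sub>F h in F. dist (\<phi> h) \<psi> < e"
  proof eventually_elim
    case (elim h)
    then have "norm (\<phi> h - \<psi>) \<le> e / 2" by (intro norm_bval_bound) simp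
    then show ?case using \<open>e > 0\<close> by (simp add: dist_norm)
  qed
qed

lemma tendsto_bval: "(\<phi> \<longlongrightarrow> \<psi>) F \<Longrightarrow> ((\<lambda>h. bval (\<phi> h) s) \<longlongrightarrow> bval \<psi> s) F"
  unfolding tendsto_iff
  by (blast intro: eventually_mono dist_fun_lt_imp_dist_val_lt)

text \<open>Meaningful only for uniformly bounded \<open>Q\<close>.\<close>

definition weighted :: "(real \<Rightarrow> 'a \<Rightarrow>\<^sub>L 'a) \<Rightarrow> (real \<Rightarrow> real)
    \<Rightarrow> (real discrete \<Rightarrow>\<^sub>C 'a::real_normed_vector) \<Rightarrow>\<^sub>L (real discrete \<Rightarrow>\<^sub>C 'a)" where
  "weighted Q \<sigma> = Blinfun (\<lambda>\<phi>. bfun (\<lambda>s. Q s (bval \<phi> (\<sigma> s))))"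

lemma
  assumes Q: "\<And>s. norm (Q s) \<le> K"
  shows bval_weighted: "bval (weighted Q \<sigma> \<phi>) s = Q s (bval \<phi> (\<sigma> s))"
    and norm_weighted: "norm (weighted Q \<sigma>) \<le> K"
proof -
  have le: "norm (Q s (bval \<phi> (\<sigma> s))) \<le> K * norm \<phi>" for s \<phi>
    using norm_blinfun[of "Q s" "bval \<phi> (\<sigma> s)"] Q[of s] norm_bounded[of \<phi> "discrete (\<sigma> s)"]
    by (meson mult_mono norm_ge_zero order_trans)
  have K: "K \<ge> 0" using Q norm_ge_zero order_trans by blast
  define G where "G = (\<lambda>\<phi>. bfun (\<lambda>s. Q s (bval \<phi> (\<sigma> s))))"
  have bv: "bval (G \<phi>) s = Q s (bval \<phi> (\<sigma> s))" for \<phi> s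
    unfolding G_def by (rule bval_bfun) (rule le)
  have "bounded_linear G"
    by (rule bounded_linear_intro[where K = K])
      (auto intro!: bval_eqI norm_bval_bound simp: bv blinfun.add_right blinfun.scaleR_right
        mult.commute[of _ K] le)
  then show *: "bval (weighted Q \<sigma> \<phi>) s = Q s (bval \<phi> (\<sigma> s))" for \<phi> s
    by (simp add: weighted_def G_def[symmetric] bounded_linear_Blinfun_apply bv)
  show "norm (weighted Q \<sigma>) \<le> K"
    by (rule norm_blinfun_bound[OF K]) (auto intro!: norm_bval_bound simp: * le)
qed

text \<open>This becomes the \<open>J\<close> of the locale \<open>chernoff\<close>.\<close>

definition c0_embed :: "'a::real_normed_vector c0fun \<Rightarrow>\<^sub>L (real discrete \<Rightarrow>\<^sub>C 'a)" where
  "c0_embed = Blinfun (\<lambda>f. bfun (c0_apply f))"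

lemma bval_c0_embed [simp]: "bval (c0_embed f) s = c0_apply f s"
proof -
  define G where "G = (\<lambda>f :: 'a c0fun. bfun (c0_apply f))"
  have bv: "bval (G f) s = c0_apply f s" for f s
    unfolding G_def by (rule bval_bfun) (rule norm_c0_apply_le)
  have "bounded_linear G"
    by (rule bounded_linear_intro[where K = 1])
      (auto intro!: bval_eqI norm_bval_bound
        simp: bv plus_c0fun.rep_eq scaleR_c0fun.rep_eq norm_c0_apply_le)
  then show ?thesis by (simp add: c0_embed_def G_def[symmetric] bounded_linear_Blinfun_apply bv)
qed

section \<open>Translations\<close>

lemma c0_small_outside:
  assumes "e > 0"
  obtains b where "b \<ge> 0" "\<And>s. \<bar>s\<bar> \<ge> b \<Longrightarrow> norm (c0_apply f s) < e"
proof -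
  have "\<forall>\<^sub>F s in at_infinity. dist (c0_apply f s) 0 < e"
    using tendsto_c0_apply assms by (rule tendstoD)
  then obtain b where "\<And>s. b \<le> norm s \<Longrightarrow> norm (c0_apply f s) < e"
    unfolding eventually_at_infinity by auto
  then show thesis by (intro that[of "max b 0"]) auto
qed

lemma c0_uniformly_continuous:
  assumes e: "e > 0"
  obtains d where "d > 0" "\<And>r s. \<bar>r - s\<bar> \<le> d \<Longrightarrow> norm (c0_apply f r - c0_apply f s) \<le> e"
proof -
  obtain b where b: "b \<ge> 0" "\<And>s. \<bar>s\<bar> \<ge> b \<Longrightarrow> norm (c0_apply f s) < e / 2"
    using c0_small_outside[of "e / 2" f] e by auto
  have "uniformly_continuous_on (cball 0 (b + 1)) (c0_apply f)"
    by (rule compact_uniformly_continuous) (auto intro: continuous_on_subset[OF continuous_c0_apply])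
  then obtain d where d: "d > 0" "\<And>r s. r \<in> cball 0 (b + 1) \<Longrightarrow> s \<in> cball 0 (b + 1) \<Longrightarrow>
      dist r s < d \<Longrightarrow> dist (c0_apply f r) (c0_apply f s) < e"
    using e unfolding uniformly_continuous_on_def by metis
  show thesis
  \<comment> \<open>At distance at most 1, a point beyond radius \<open>b + 1\<close> forces the
    other beyond radius \<open>b\<close>, where both values are below \<open>e / 2\<close>.\<close>
  proof (rule that[of "min 1 (d / 2)"])
    show "0 < min 1 (d / 2)" using d by simp
    fix r s :: real assume rs: "\<bar>r - s\<bar> \<le> min 1 (d / 2)"
    show "norm (c0_apply f r - c0_apply f s) \<le> e"
    proof (cases "\<bar>r\<bar> \<le> b + 1 \<and> \<bar>s\<bar> \<le> b + 1")
      case True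
      then have "dist (c0_apply f r) (c0_apply f s) < e"
        using rs d(1) by (intro d(2)) (auto simp: dist_norm)
      then show ?thesis by (simp add: dist_norm)
    next
      case False
      then have "\<bar>r\<bar> \<ge> b" "\<bar>s\<bar> \<ge> b" using rs by auto
      then show ?thesis
        using b(2)[of r] b(2)[of s] norm_triangle_ineq4[of "c0_apply f r" "c0_apply f s"] by simp
    qed
  qed
qed

definition translation ::
  "real \<Rightarrow> (real discrete \<Rightarrow>\<^sub>C 'a::real_normed_vector) \<Rightarrow>\<^sub>L (real discrete \<Rightarrow>\<^sub>C 'a)" where
  "translation h = weighted (\<lambda>_. id_blinfun) (\<lambda>s. s - h)"

lemma bval_translation: "bval (translation h \<phi>) s = bval \<phi> (s - h)"
  unfolding translation_def by (subst bval_weighted[where K = 1]) (auto intro: norm_blinfun_id_le)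

lemma norm_translation: "norm (translation h) \<le> 1"
  unfolding translation_def by (rule norm_weighted) (rule norm_blinfun_id_le)

lemma translation_strongly_continuous:
  "((\<lambda>h. translation h (c0_embed f)) \<longlongrightarrow> c0_embed f) (at_right 0)"
proof (rule tendsto_bvalI)
  fix e :: real assume "e > 0"
  then obtain d where d: "d > 0" "\<And>r s. \<bar>r - s\<bar> \<le> d \<Longrightarrow> norm (c0_apply f r - c0_apply f s) \<le> e"
    using c0_uniformly_continuous by blast
  show "\<forall>\<^sub>F h in at_right 0. \<forall>s. norm (bval (translation h (c0_embed f)) s - bval (c0_embed f) s) \<le> e"
    using eventually_at_right_le[OF d(1)] by eventually_elim (simp add: bval_translation d(2))
qed

lemma in_generator_translation:
  assumes f: "f \<in> op_dom neg_deriv"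
  shows "in_generator translation (c0_embed f) (c0_embed (op_app neg_deriv f))"
  unfolding in_generator_def
proof (rule tendsto_bvalI)
  define g where "g = Abs_c0fun (\<lambda>s. vector_derivative (c0_apply f) (at s))"
  have g: "c0_apply g s = vector_derivative (c0_apply f) (at s)" for s
    using f by (simp add: g_def neg_deriv_def Abs_c0fun_inverse)
  have df: "(c0_apply f has_vector_derivative c0_apply g s) (at s)" for s
    using f unfolding g by (simp add: neg_deriv_def vector_derivative_works[symmetric])
  have ng: "op_app neg_deriv f = - g" by (simp add: neg_deriv_def g_def)
  fix e :: real assume "e > 0"
  then obtain d where d: "d > 0" "\<And>r s. \<bar>r - s\<bar> \<le> d \<Longrightarrow> norm (c0_apply g r - c0_apply g s) \<le> e"
    using c0_uniformly_continuous by blast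
  have est: "norm (c0_apply f (s - h) - c0_apply f s + h *\<^sub>R c0_apply g s) \<le> h * e"
    if h: "0 < h" "h \<le> d" for s h
  proof -
    \<comment> \<open>Its derivative is \<open>g s - g (s - \<tau>)\<close>, of norm at most
      \<open>e\<close> by uniform continuity of \<open>g\<close>; the mean value inequality then
      works for all \<open>s\<close> at once.\<close>
    define k where "k = (\<lambda>\<tau>. c0_apply f (s - \<tau>) + \<tau> *\<^sub>R c0_apply g s)"
    have "norm (k h - k 0) \<le> e * norm (h - 0)"
    proof (rule differentiable_bound[where S = "{0..h}"
          and f' = "\<lambda>\<tau> x. x *\<^sub>R (c0_apply g s - c0_apply g (s - \<tau>))"])
      fix \<tau> assume \<tau>: "\<tau> \<in> {0..h}"
      have "((c0_apply f \<circ> (\<lambda>\<tau>. s - \<tau>)) has_vector_derivative (- 1) *\<^sub>R c0_apply g (s - \<tau>))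
          (at \<tau> within {0..h})"
        by (rule vector_diff_chain_within)
          (auto intro!: derivative_eq_intros has_vector_derivative_at_within[OF df])
      then have "(k has_vector_derivative (- 1) *\<^sub>R c0_apply g (s - \<tau>) + 1 *\<^sub>R c0_apply g s)
          (at \<tau> within {0..h})"
        unfolding k_def o_def
        by (intro has_vector_derivative_add) (auto intro!: derivative_eq_intros)
      then show "(k has_derivative (\<lambda>x. x *\<^sub>R (c0_apply g s - c0_apply g (s - \<tau>)))) (at \<tau> within {0..h})"
        by (simp add: has_vector_derivative_def)
      have "norm (c0_apply g s - c0_apply g (s - \<tau>)) \<le> e"
        using \<tau> h by (intro d(2)) auto
      then show "onorm (\<lambda>x. x *\<^sub>R (c0_apply g s - c0_apply g (s - \<tau>))) \<le> e"
        by (intro onorm_le) (simp, metis abs_ge_zero mult.commute mult_left_mono)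
    qed (use h in auto)
    then show ?thesis using h by (simp add: k_def mult.commute[of e] add_diff_eq diff_add_eq)
  qed
  show "\<forall>\<^sub>F h in at_right 0. \<forall>s. norm (bval ((translation h (c0_embed f) - c0_embed f) /\<^sub>R h) s
      - bval (c0_embed (op_app neg_deriv f)) s) \<le> e"
    using eventually_at_right_le[OF d(1)]
  proof eventually_elim
    case (elim h)
    show ?case
    proof
      fix s
      have "bval ((translation h (c0_embed f) - c0_embed f) /\<^sub>R h) s - bval (c0_embed (op_app neg_deriv f)) s
          = (c0_apply f (s - h) - c0_apply f s + h *\<^sub>R c0_apply g s) /\<^sub>R h"
        using elim by (simp add: bval_translation ng uminus_c0fun.rep_eq scaleR_add_right)
      then show "norm (bval ((translation h (c0_embed f) - c0_embed f) /\<^sub>R h) s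
          - bval (c0_embed (op_app neg_deriv f)) s) \<le> e"
        using est[of h s] elim by (simp only: norm_scaleR_inverse_le)
    qed
  qed
qed

section \<open>Multiplication semigroups\<close>

text \<open>Hypotheses (b) and (c) for a single family, to be instantiated once with
  \<open>A\<close> and once with \<open>B\<close>.\<close>

locale semigroup_family =
  fixes A :: "real \<Rightarrow> 'a::banach operator" and S :: "real \<Rightarrow> real \<Rightarrow> 'a \<Rightarrow>\<^sub>L 'a" and M \<omega> :: real
  assumes gen: "\<And>r. generates (A r) (S r)"
    and S_bound: "\<And>r t. t \<ge> 0 \<Longrightarrow> norm (S r t) \<le> M * exp (\<omega> * t)"
    and res_continuous: "\<And>\<mu> x. \<mu> > \<omega> \<Longrightarrow> continuous_on UNIV (\<lambda>t. resolvent \<mu> (A t) x)"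
begin

sublocale sg: bounded_C0_semigroup "S r" M \<omega> for r
  using gen S_bound by unfold_locales (auto simp: generates_def)

definition mult :: "real \<Rightarrow> (real discrete \<Rightarrow>\<^sub>C 'a) \<Rightarrow>\<^sub>L (real discrete \<Rightarrow>\<^sub>C 'a)" where
  "mult h = weighted (\<lambda>r. S r h) (\<lambda>r. r)"

lemma bval_mult: "h \<ge> 0 \<Longrightarrow> bval (mult h \<phi>) r = S r h (bval \<phi> r)"
  unfolding mult_def by (rule bval_weighted[OF S_bound])

abbreviation K where "K \<equiv> M * exp \<bar>\<omega>\<bar>"

lemma norm_S_le: "0 \<le> h \<Longrightarrow> h \<le> 1 \<Longrightarrow> norm (S r h x) \<le> K * norm x"
  using sg.norm_S_le[of h 1 r x] by simp

lemma K_nonneg: "K \<ge> 0"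
  using order_trans[OF norm_ge_zero S_bound[of 0 0]] by simp

lemma norm_mult: "0 \<le> h \<Longrightarrow> h \<le> 1 \<Longrightarrow> norm (mult h) \<le> K"
  unfolding mult_def
  by (rule norm_weighted) (auto intro!: norm_blinfun_bound norm_S_le K_nonneg)

lemma eventually_norm_mult: "\<forall>\<^sub>F h in at_right 0. norm (mult h) \<le> K"
  using eventually_at_right_le[OF zero_less_one] by eventually_elim (auto intro: norm_mult)

lemma mult_continuous_locally:
  assumes e: "e > 0"
  shows "\<exists>U. open U \<and> r0 \<in> U \<and>
    (\<forall>\<^sub>F h in at_right 0. \<forall>r\<in>U. norm (S r h (c0_apply g r) - c0_apply g r) \<le> e)"
proof -
  define \<mu> where "\<mu> = \<omega> + 1"
  have \<mu>: "\<mu> > \<omega>" by (simp add: \<mu>_def)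
  define \<epsilon> where "\<epsilon> = e / 2 / (K + 1)"
  have \<epsilon>: "\<epsilon> > 0" using e K_nonneg by (simp add: \<epsilon>_def)
  \<comment> \<open>Near \<open>r0\<close>, approximate \<open>g\<close> by \<open>y r = R(\<mu>, A(r)) z\<close>: it lies in the domain of \<open>A(r)\<close>, depends
    continuously on \<open>r\<close>, and \<open>A(r) (y r)\<close> is locally bounded.\<close>
  obtain y0 a where y0: "in_generator (S r0) y0 a" "norm (y0 - c0_apply g r0) < \<epsilon>"
    using sg.generator_dense[OF \<epsilon>] by blast
  define z where "z = \<mu> *\<^sub>R y0 - a"
  define y where "y = (\<lambda>r. resolvent \<mu> (A r) z)"
  have y_gen: "in_generator (S r) (y r) (\<mu> *\<^sub>R y r - z)" for r
    using sg.resolvent_eq_iff[OF gen[of r] \<mu>, of z "y r"] by (simp add: y_def)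
  have "y r0 = y0"
    unfolding y_def using y0(1) by (subst sg.resolvent_eq_iff[OF gen \<mu>]) (simp add: z_def)
  have y_cont: "continuous_on UNIV y"
    unfolding y_def by (rule res_continuous[OF \<mu>])
  define B where "B = norm (\<mu> *\<^sub>R y0 - z) + 1"
  define U where "U = {r. norm (y r - c0_apply g r) < \<epsilon>} \<inter> {r. norm (\<mu> *\<^sub>R y r - z) < B}"
  have "open U"
    unfolding U_def
    by (intro open_Int open_Collect_less continuous_intros y_cont continuous_c0_apply)
  moreover have "r0 \<in> U"
    using y0(2) by (simp add: U_def B_def \<open>y r0 = y0\<close>)
  moreover have "\<forall>\<^sub>F h in at_right 0. \<forall>r\<in>U. norm (S r h (c0_apply g r) - c0_apply g r) \<le> e"
  proof -
    have "((\<lambda>h. h * (K * B)) \<longlongrightarrow> 0) (at_right 0)"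
      by (auto intro!: tendsto_eq_intros)
    then have "\<forall>\<^sub>F h in at_right 0. h * (K * B) < e / 2"
      using e by (intro order_tendstoD(2)) auto
    moreover have "\<forall>\<^sub>F h in at_right 0. 0 < h \<and> h \<le> (1::real)"
      by (rule eventually_at_right_le) simp
    ultimately show ?thesis
    proof eventually_elim
      case (elim h)
      show ?case
      proof
        fix r assume r: "r \<in> U"
        define d where "d = c0_apply g r - y r"
        have d: "norm d \<le> \<epsilon>" using r by (simp add: U_def d_def norm_minus_commute)
        have "norm (S r h d - d) \<le> K * norm d + norm d"
          using norm_S_le[of h r d] elim norm_triangle_ineq4[of "S r h d" d] by simp
        also have "\<dots> = (K + 1) * norm d" by (simp add: algebra_simps)
        also have "\<dots> \<le> (K + 1) * \<epsilon>"
          using d K_nonneg by (intro mult_left_mono) auto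
        also have "\<dots> = e / 2"
          using K_nonneg nonzero_mult_div_cancel_left[of "K + 1" "e / 2"] by (simp add: \<epsilon>_def)
        finally have 1: "norm (S r h d - d) \<le> e / 2" .
        have "norm (S r h (y r) - y r) \<le> h * ((M * exp (\<bar>\<omega>\<bar> * h)) * norm (\<mu> *\<^sub>R y r - z))"
          using elim by (intro sg.norm_S_diff_le y_gen) auto
        also have "\<dots> \<le> h * (K * B)"
        proof -
          have "0 \<le> M" using K_nonneg by (simp add: zero_le_mult_iff)
          moreover have "\<bar>\<omega>\<bar> * h \<le> \<bar>\<omega>\<bar>" using elim by (simp add: mult_left_le)
          ultimately show ?thesis
            using r elim by (intro mult_left_mono mult_mono) (auto simp: U_def B_def)
        qed
        finally have 2: "norm (S r h (y r) - y r) \<le> e / 2" using elim by simp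
        have "S r h (c0_apply g r) - c0_apply g r = (S r h d - d) + (S r h (y r) - y r)"
          by (simp add: d_def blinfun.diff_right)
        then show "norm (S r h (c0_apply g r) - c0_apply g r) \<le> e"
          using 1 2 norm_triangle_ineq[of "S r h d - d" "S r h (y r) - y r"] by simp
      qed
    qed
  qed
  ultimately show ?thesis by blast
qed

lemma S_uniformly_continuous:
  assumes e: "e > 0"
  shows "\<forall>\<^sub>F h in at_right 0. \<forall>r. norm (S r h (c0_apply g r) - c0_apply g r) \<le> e"
proof -
  obtain b where b: "b \<ge> 0" "\<And>s. \<bar>s\<bar> \<ge> b \<Longrightarrow> norm (c0_apply g s) < e / (K + 1)"
    using c0_small_outside[of "e / (K + 1)" g] e K_nonneg by auto
  have "\<forall>\<^sub>F h in at_right 0. \<forall>r\<in>cball 0 b. norm (S r h (c0_apply g r) - c0_apply g r) \<le> e"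
  proof (rule eventually_ball_compact)
    fix r0 :: real
    obtain U where "open U" "r0 \<in> U"
      "\<forall>\<^sub>F h in at_right 0. \<forall>r\<in>U. norm (S r h (c0_apply g r) - c0_apply g r) \<le> e"
      using mult_continuous_locally[OF e] by blast
    then show "\<exists>U. open U \<and> r0 \<in> U \<and> (\<forall>\<^sub>F h in at_right 0. \<forall>r\<in>U \<inter> cball 0 b.
        norm (S r h (c0_apply g r) - c0_apply g r) \<le> e)"
      by (intro exI[of _ U]) (auto elim!: eventually_mono)
  qed simp
  moreover have "\<forall>\<^sub>F h in at_right 0. 0 < h \<and> h \<le> (1::real)"
    by (rule eventually_at_right_le) simp
  ultimately show ?thesis
  proof eventually_elim
    case (elim h)
    show ?case
    proof
      fix r
      show "norm (S r h (c0_apply g r) - c0_apply g r) \<le> e"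
      proof (cases "\<bar>r\<bar> \<le> b")
        case True
        then show ?thesis using elim by simp
      next
        case False
        have "norm (S r h (c0_apply g r) - c0_apply g r) \<le> (K + 1) * norm (c0_apply g r)"
          using norm_S_le[of h r "c0_apply g r"] elim
            norm_triangle_ineq4[of "S r h (c0_apply g r)" "c0_apply g r"]
          by (simp add: algebra_simps)
        also have "\<dots> \<le> (K + 1) * (e / (K + 1))"
          using b(2)[of r] False K_nonneg by (intro mult_left_mono) auto
        also have "\<dots> = e" using K_nonneg by simp
        finally show ?thesis .
      qed
    qed
  qed
qed

lemma mult_strongly_continuous: "((\<lambda>h. mult h (c0_embed g)) \<longlongrightarrow> c0_embed g) (at_right 0)"
proof (rule tendsto_bvalI)
  fix e :: real assume "e > 0"
  from S_uniformly_continuous[OF this, of g] eventually_at_right_less[of 0]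
  show "\<forall>\<^sub>F h in at_right 0. \<forall>s. norm (bval (mult h (c0_embed g)) s - bval (c0_embed g) s) \<le> e"
    by eventually_elim (simp add: bval_mult)
qed

lemma in_generator_mult:
  assumes f: "f \<in> op_dom (mult_operator A)"
  shows "in_generator mult (c0_embed f) (c0_embed (op_app (mult_operator A) f))"
  unfolding in_generator_def
proof (rule tendsto_bvalI)
  define g where "g = op_app (mult_operator A) f"
  have g: "in_generator (S r) (c0_apply f r) (c0_apply g r)" for r
    using f by (simp add: generates_in_generator[OF gen] g_def mult_operator_def Abs_c0fun_inverse)
  fix e :: real assume e: "e > 0"
  obtain d where d: "d > 0" "\<And>h r. 0 < h \<Longrightarrow> h < d \<Longrightarrow> norm (S r h (c0_apply g r) - c0_apply g r) \<le> e"
    using S_uniformly_continuous[OF e, of g] unfolding eventually_at_right_field by blast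
  have "\<forall>\<^sub>F h in at_right 0. 0 < h \<and> h \<le> d / 2"
    using d by (intro eventually_at_right_le) simp
  then show "\<forall>\<^sub>F h in at_right 0. \<forall>s. norm (bval ((mult h (c0_embed f) - c0_embed f) /\<^sub>R h) s
      - bval (c0_embed (op_app (mult_operator A) f)) s) \<le> e"
  proof eventually_elim
    case (elim h)
    show ?case
    proof
      fix s
      have "norm (S s \<tau> (c0_apply g s) - c0_apply g s) \<le> e" if "0 \<le> \<tau>" "\<tau> \<le> h" for \<tau>
        using that elim e d by (cases "\<tau> = 0") auto
      then have "norm (S s h (c0_apply f s) - c0_apply f s - h *\<^sub>R c0_apply g s) \<le> h * e"
        using elim by (intro sg.norm_generator_error_le[OF g]) auto
      moreover have "bval ((mult h (c0_embed f) - c0_embed f) /\<^sub>R h) s - bval (c0_embed g) s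
          = (S s h (c0_apply f s) - c0_apply f s - h *\<^sub>R c0_apply g s) /\<^sub>R h"
        using elim by (simp add: bval_mult scaleR_diff_right)
      ultimately show "norm (bval ((mult h (c0_embed f) - c0_embed f) /\<^sub>R h) s
          - bval (c0_embed (op_app (mult_operator A) f)) s) \<le> e"
        using elim unfolding g_def[symmetric] by (simp only: norm_scaleR_inverse_le)
    qed
  qed
qed

end


section \<open>Splitting formulas\<close>

lemma oprod_inc_Suc_left: "oprod_inc U (Suc n) = U 0 o\<^sub>L oprod_inc (\<lambda>p. U (Suc p)) n"
proof (induction n)
  case (Suc n)
  have "oprod_inc U (Suc (Suc n)) = (U 0 o\<^sub>L oprod_inc (\<lambda>p. U (Suc p)) n) o\<^sub>L U (Suc n)"
    using Suc by simp
  also have "\<dots> = U 0 o\<^sub>L oprod_inc (\<lambda>p. U (Suc p)) (Suc n)"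
    by (rule blinfun_eqI) simp
  finally show ?case .
qed (auto intro: blinfun_eqI)

lemma oprod_inc_cong: "(\<And>p. p < n \<Longrightarrow> U p = U' p) \<Longrightarrow> oprod_inc U n = oprod_inc U' n"
  by (induction n) auto

lemma oprod_dec_eq_oprod_inc: "oprod_dec U n = oprod_inc (\<lambda>p. U (n - Suc p)) n"
proof (induction n)
  case (Suc n)
  show ?case by (simp only: oprod_inc_Suc_left oprod_dec.simps Suc) simp
qed simp

lemma oprod_inc_scaleR: "oprod_inc (\<lambda>p. c *\<^sub>R U p) n = c ^ n *\<^sub>R oprod_inc U n"
  by (induction n) (auto intro!: blinfun_eqI simp: blinfun.scaleR_left blinfun.scaleR_right)

lemma oprod_dec_scaleR: "oprod_dec (\<lambda>p. c *\<^sub>R U p) n = c ^ n *\<^sub>R oprod_dec U n"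
  by (induction n) (auto intro!: blinfun_eqI simp: blinfun.scaleR_left blinfun.scaleR_right)

lemma bval_oprod_dec:
  fixes F :: "(real discrete \<Rightarrow>\<^sub>C 'a::real_normed_vector) \<Rightarrow>\<^sub>L (real discrete \<Rightarrow>\<^sub>C 'a)"
    and V :: "real \<Rightarrow> 'a \<Rightarrow>\<^sub>L 'a"
  assumes F: "\<And>\<phi> s. bval (F \<phi>) s = V (s - h) (bval \<phi> (s - h))"
  shows "bval (oprod_dec (\<lambda>_. F) n \<phi>) s
    = oprod_inc (\<lambda>p. V (s - real (Suc p) * h)) n (bval \<phi> (s - real n * h))"
proof (induction n arbitrary: s)
  case (Suc n)
  have "s - h - real (Suc p) * h = s - real (Suc (Suc p)) * h" for p
    by (simp add: algebra_simps)
  moreover have "s - h - real n * h = s - real (Suc n) * h"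
    by (simp add: algebra_simps)
  ultimately show ?case
    unfolding oprod_inc_Suc_left by (simp only: oprod_dec.simps blinfun_apply_blinfun_compose F Suc) simp
qed simp

lemma ex_c0fun: "\<exists>f. c0_apply f s = x"
proof -
  let ?f = "\<lambda>r. max 0 (1 - \<bar>r - s\<bar>) *\<^sub>R x"
  have "\<forall>\<^sub>F r in at_infinity. ?f r = 0"
    unfolding eventually_at_infinity by (intro exI[of _ "\<bar>s\<bar> + 1"]) auto
  then have "(?f \<longlongrightarrow> 0) at_infinity"
    by (rule tendsto_eventually)
  moreover have "continuous_on UNIV ?f"
    by (intro continuous_intros)
  ultimately have "?f \<in> c0_funs" by (simp add: c0_funs_def)
  then show ?thesis
    by (intro exI[of _ "Abs_c0fun ?f"]) (simp add: Abs_c0fun_inverse)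
qed

lemma evolution_semigroup_bounded:
  assumes W: "evolution_family W" and C0: "C0_semigroup (evolution_semigroup W)"
  obtains M \<omega> where "bounded_C0_semigroup (evolution_semigroup W) M \<omega>"
proof -
  obtain M \<omega> where M: "M \<ge> 1" "\<And>s t. s \<le> t \<Longrightarrow> norm (W t s) \<le> M * exp (\<omega> * (t - s))"
    using W unfolding evolution_family_def by blast
  have "norm (evolution_semigroup W t) \<le> M * exp (\<omega> * t)" if t: "t \<ge> 0" for t
  proof (rule norm_blinfun_bound)
    fix f
    show "norm (evolution_semigroup W t f) \<le> M * exp (\<omega> * t) * norm f"
    proof (rule norm_c0fun_le)
      fix s
      have "norm (W s (s - t) (c0_apply f (s - t))) \<le> norm (W s (s - t)) * norm (c0_apply f (s - t))"
        by (rule norm_blinfun)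
      also have "\<dots> \<le> (M * exp (\<omega> * t)) * norm f"
        using M(2)[of "s - t" s] M(1) t by (intro mult_mono norm_c0_apply_le) auto
      finally show "norm (c0_apply (evolution_semigroup W t f) s) \<le> M * exp (\<omega> * t) * norm f"
        by (simp add: evolution_semigroup_apply[OF W t])
    qed
  qed (use M in simp)
  then show thesis
    using C0 by (intro that[of M \<omega>]) (unfold_locales, auto)
qed

theorem splitting_converges:
  fixes A B :: "real \<Rightarrow> 'a::banach operator" and V :: "real \<Rightarrow> real \<Rightarrow> 'a \<Rightarrow>\<^sub>L 'a"
    and V' :: "real \<Rightarrow> (real discrete \<Rightarrow>\<^sub>C 'a) \<Rightarrow>\<^sub>L (real discrete \<Rightarrow>\<^sub>C 'a)"
  assumes W: "evolution_family W"
    and closable: "closable (op_sum (op_sum neg_deriv (mult_operator A)) (mult_operator B))"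
    and gen: "generates
          (op_closure (op_sum (op_sum neg_deriv (mult_operator A)) (mult_operator B)))
          (evolution_semigroup W)"
    and M: "M \<ge> 1"
    and V': "\<And>h \<phi> r. h \<ge> 0 \<Longrightarrow> bval (V' h \<phi>) r = V r h (bval \<phi> r)"
    and V_0: "\<And>r. V r 0 = id_blinfun"
    and stable: "\<And>h n s. h > 0 \<Longrightarrow> n \<ge> 1 \<Longrightarrow>
          norm (oprod_inc (\<lambda>p. V (s - real p * h) h) n) \<le> M * exp (\<omega> * (real n * h))"
    and consistent: "\<And>f. f \<in> op_dom (mult_operator A) \<Longrightarrow> f \<in> op_dom (mult_operator B) \<Longrightarrow>
          in_generator V' (c0_embed f) (c0_embed (op_app (mult_operator A) f + op_app (mult_operator B) f))"
    and st: "s \<le> t"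
  shows "(\<lambda>n. oprod_dec (\<lambda>p. V (s + real p * ((t - s) / real n)) ((t - s) / real n)) n x)
    \<longlonglongrightarrow> W t s x"
proof -
  let ?C = "op_sum (op_sum neg_deriv (mult_operator A)) (mult_operator B)"
  define F where "F = (\<lambda>h. translation h o\<^sub>L V' h)"
  have F: "bval (F h \<phi>) s = V (s - h) h (bval \<phi> (s - h))" if "h \<ge> 0" for h \<phi> s
    by (simp add: F_def bval_translation V' that)
  have F_power: "bval (oprod_dec (\<lambda>_. F h) n \<phi>) s
      = oprod_inc (\<lambda>p. V (s - real (Suc p) * h) h) n (bval \<phi> (s - real n * h))" if "h \<ge> 0" for h n \<phi> s
    by (rule bval_oprod_dec[where V = "\<lambda>r. V r h"]) (rule F[OF that])
  obtain M' \<omega>' where T: "bounded_C0_semigroup (evolution_semigroup W) M' \<omega>'"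
    using evolution_semigroup_bounded[OF W] gen unfolding generates_def by blast
  interpret T: bounded_C0_semigroup "evolution_semigroup W" M' \<omega>' by (rule T)
  interpret chernoff "evolution_semigroup W" M' \<omega>' c0_embed F "op_graph ?C" M "max \<omega> 0"
  proof
    show "F 0 = id_blinfun"
      by (intro blinfun_eqI bval_eqI) (simp add: F V_0)
    show "norm (oprod_dec (\<lambda>_. F h) n) \<le> M * exp (max \<omega> 0 * (real n * h))" if h: "h > 0" for h n
    proof (rule norm_blinfun_bound)
      fix \<phi> :: "real discrete \<Rightarrow>\<^sub>C 'a"
      show "norm (oprod_dec (\<lambda>_. F h) n \<phi>) \<le> M * exp (max \<omega> 0 * (real n * h)) * norm \<phi>"
      proof (rule norm_bval_bound)
        fix s
        let ?P = "oprod_inc (\<lambda>p. V (s - real (Suc p) * h) h) n"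
        have P: "?P = oprod_inc (\<lambda>p. V ((s - h) - real p * h) h) n"
          by (simp add: algebra_simps)
        have "norm ?P \<le> M * exp (\<omega> * (real n * h))"
        proof (cases "n = 0")
          case True
          then show ?thesis using M norm_blinfun_id_le order_trans by auto
        next
          case False
          then show ?thesis unfolding P using h by (intro stable) auto
        qed
        also have "\<dots> \<le> M * exp (max \<omega> 0 * (real n * h))"
          using M h by (intro mult_left_mono) (auto intro!: mult_right_mono)
        finally show "norm (bval (oprod_dec (\<lambda>_. F h) n \<phi>) s)
            \<le> M * exp (max \<omega> 0 * (real n * h)) * norm \<phi>"
          unfolding F_power[OF less_imp_le[OF h]] using M
          by (intro order_trans[OF norm_blinfun] mult_mono norm_bounded) auto
      qed
    qed (use M in simp)
    show "((\<lambda>h. (F h (c0_embed f) - c0_embed f) /\<^sub>R h) \<longlongrightarrow> c0_embed g) (at_right 0)"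
      if fg: "(f, g) \<in> op_graph ?C" for f g
    proof -
      let ?b = "op_app (mult_operator A) f + op_app (mult_operator B) f"
      have f: "f \<in> op_dom neg_deriv" "f \<in> op_dom (mult_operator A)" "f \<in> op_dom (mult_operator B)"
        and g: "g = op_app neg_deriv f + ?b"
        using fg by (auto simp: op_graph_def op_sum_def)
      have "in_generator F (c0_embed f) (c0_embed (op_app neg_deriv f) + c0_embed ?b)"
        unfolding F_def
        by (rule in_generator_compose[OF always_eventually[OF allI[OF norm_translation]]
              in_generator_translation consistent translation_strongly_continuous]) (use f in auto)
      then show ?thesis
        by (simp add: g in_generator_def blinfun.add_right add.assoc)
    qed
    show "(f, g) \<in> closure (op_graph ?C)" if "in_generator (evolution_semigroup W) f g" for f g
      using that gen op_graph_op_closure[OF closable]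
      unfolding generates_def by (simp add: op_graph_generator[symmetric])
  qed simp
  obtain f where f: "c0_apply f s = x" using ex_c0fun by blast
  have lim: "(\<lambda>n. bval (oprod_dec (\<lambda>_. F ((t - s) / real n)) n (c0_embed f)) t)
      \<longlonglongrightarrow> bval (c0_embed (evolution_semigroup W (t - s) f)) t"
    using st by (intro tendsto_bval product_formula) simp
  have val: "bval (c0_embed (evolution_semigroup W (t - s) f)) t = W t s x"
    using st by (simp add: evolution_semigroup_apply[OF W] f)
  have "\<forall>\<^sub>F n in sequentially. bval (oprod_dec (\<lambda>_. F ((t - s) / real n)) n (c0_embed f)) t
      = oprod_dec (\<lambda>p. V (s + real p * ((t - s) / real n)) ((t - s) / real n)) n x"
    using eventually_gt_at_top[of 0]
  proof eventually_elim
    case (elim n)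
    define h where "h = (t - s) / real n"
    have h: "h \<ge> 0" "real n * h = t - s" using st elim by (auto simp: h_def)
    have "t - real (Suc p) * h = s + real (n - Suc p) * h" if "p < n" for p
      using that h by (simp add: of_nat_diff algebra_simps)
    then have "oprod_inc (\<lambda>p. V (t - real (Suc p) * h) h) n
        = oprod_inc (\<lambda>p. V (s + real (n - Suc p) * h) h) n"
      by (intro oprod_inc_cong) (simp only:)
    then show ?case
      unfolding h_def[symmetric] F_power[OF h(1)] h(2)
        oprod_dec_eq_oprod_inc[of "\<lambda>p. V (s + real p * h) h"]
      by (simp add: f)
  qed
  then show ?thesis
    by (rule Lim_transform_eventually[OF lim[unfolded val]])
qed

theorem theorem4p1:
  fixes A B :: "real \<Rightarrow> 'a::banach operator"
    and expA expB :: "real \<Rightarrow> real \<Rightarrow> 'a \<Rightarrow>\<^sub>L 'a"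
    and W :: "real \<Rightarrow> real \<Rightarrow> 'a \<Rightarrow>\<^sub>L 'a"
    and M \<omega> :: real
  assumes lin: "\<And>t. linear_operator (A t)" "\<And>t. linear_operator (B t)"
    and a_wp: "well_posed (\<lambda>t. op_sum (A t) (B t))"
    and a_W: "evolution_family W" "solves_ncp W (\<lambda>t. op_sum (A t) (B t))"
    and a_closable: "closable (op_sum (op_sum neg_deriv (mult_operator A)) (mult_operator B))"
    and a_gen: "generates
          (op_closure (op_sum (op_sum neg_deriv (mult_operator A)) (mult_operator B)))
          (evolution_semigroup W)"
    and b_M: "M \<ge> 1"
    and b_A: "\<And>r. generates (A r) (expA r)" "\<And>r t. t \<ge> 0 \<Longrightarrow> norm (expA r t) \<le> M * exp (\<omega> * t)"
    and b_B: "\<And>r. generates (B r) (expB r)" "\<And>r t. t \<ge> 0 \<Longrightarrow> norm (expB r t) \<le> M * exp (\<omega> * t)"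
    and c_A: "\<And>\<mu> x. \<mu> > \<omega> \<Longrightarrow> continuous_on UNIV (\<lambda>t. resolvent \<mu> (A t) x)"
    and c_B: "\<And>\<mu> x. \<mu> > \<omega> \<Longrightarrow> continuous_on UNIV (\<lambda>t. resolvent \<mu> (B t) x)"
  shows
    "((\<forall>t\<ge>0. \<forall>n\<ge>1. \<forall>s.
         norm (oprod_inc (\<lambda>p.
             expA (s - real p * t / real n) (t / (2 * real n)) o\<^sub>L
             expB (s - real p * t / real n) (t / real n) o\<^sub>L
             expA (s - real p * t / real n) (t / (2 * real n))) n)
           \<le> M * exp (\<omega> * t))
      \<longrightarrow> (\<forall>x t s. s \<le> t \<longrightarrow>
           (\<lambda>n. oprod_dec (\<lambda>p.
               expA (s + real p * (t - s) / real n) ((t - s) / (2 * real n)) o\<^sub>L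
               expB (s + real p * (t - s) / real n) ((t - s) / real n) o\<^sub>L
               expA (s + real p * (t - s) / real n) ((t - s) / (2 * real n))) n x)
             \<longlonglongrightarrow> W t s x))
     \<and>
     ((\<forall>t\<ge>0. \<forall>n\<ge>1. \<forall>s.
         1 / 2 ^ n * norm (oprod_inc (\<lambda>p.
             (expA (s - real p * t / real n) (t / real n) o\<^sub>L
              expB (s - real p * t / real n) (t / real n)) +
             (expB (s - real p * t / real n) (t / real n) o\<^sub>L
              expA (s - real p * t / real n) (t / real n))) n)
           \<le> M * exp (\<omega> * t))
      \<longrightarrow> (\<forall>x t s. s \<le> t \<longrightarrow>
           (\<lambda>n. (1 / 2 ^ n) *\<^sub>R oprod_dec (\<lambda>p.
               (expA (s + real p * (t - s) / real n) ((t - s) / real n) o\<^sub>L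
                expB (s + real p * (t - s) / real n) ((t - s) / real n)) +
               (expB (s + real p * (t - s) / real n) ((t - s) / real n) o\<^sub>L
                expA (s + real p * (t - s) / real n) ((t - s) / real n))) n x)
             \<longlonglongrightarrow> W t s x))"
proof (intro conjI impI allI)
  interpret A: semigroup_family A expA M \<omega>
    using b_A c_A by unfold_locales
  interpret B: semigroup_family B expB M \<omega>
    using b_B c_B by unfold_locales
  have expA_0: "expA r 0 = id_blinfun" and expB_0: "expB r 0 = id_blinfun" for r
    using b_A(1)[of r] b_B(1)[of r] by (auto simp: generates_def C0_semigroup_def)
  note converges = splitting_converges[OF a_W(1) a_closable a_gen b_M]
  {
    fix x and t s :: real
    assume stable: "\<forall>t\<ge>0. \<forall>n\<ge>1. \<forall>s.
         norm (oprod_inc (\<lambda>p.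
             expA (s - real p * t / real n) (t / (2 * real n)) o\<^sub>L
             expB (s - real p * t / real n) (t / real n) o\<^sub>L
             expA (s - real p * t / real n) (t / (2 * real n))) n)
           \<le> M * exp (\<omega> * t)" and st: "s \<le> t"
    define V where "V = (\<lambda>r h. expA r (h / 2) o\<^sub>L expB r h o\<^sub>L expA r (h / 2))"
    define V' where "V' = (\<lambda>h. A.mult (h / 2) o\<^sub>L (B.mult h o\<^sub>L A.mult (h / 2)))"
    have "(\<lambda>n. oprod_dec (\<lambda>p. V (s + real p * ((t - s) / real n)) ((t - s) / real n)) n x)
      \<longlonglongrightarrow> W t s x"
    proof (rule converges[where V' = V' and \<omega> = \<omega>, OF _ _ _ _ st])
      show "bval (V' h \<phi>) r = V r h (bval \<phi> r)" if "h \<ge> 0" for h \<phi> r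
        using that by (simp add: V_def V'_def A.bval_mult B.bval_mult)
      show "V r 0 = id_blinfun" for r
        by (simp add: V_def expA_0 expB_0 blinfun_eqI)
      show "norm (oprod_inc (\<lambda>p. V (s - real p * h) h) n) \<le> M * exp (\<omega> * (real n * h))"
        if "h > 0" "n \<ge> 1" for h n s
        using stable[rule_format, of "real n * h" n s] that by (simp add: V_def)
      fix f assume fA: "f \<in> op_dom (mult_operator A)" and fB: "f \<in> op_dom (mult_operator B)"
      let ?a = "op_app (mult_operator A) f" and ?b = "op_app (mult_operator B) f"
      have half: "filterlim (\<lambda>h::real. h / 2) (at_right 0) (at_right 0)"
        by (rule filterlim_half_at_right)
      have A_half: "in_generator (\<lambda>h. A.mult (h / 2)) (c0_embed f) (c0_embed (?a /\<^sub>R 2))"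
        using in_generator_half_step[OF A.in_generator_mult[OF fA]]
        by (simp add: blinfun.scaleR_right)
      have "in_generator V' (c0_embed f) (c0_embed (?a /\<^sub>R 2) + (c0_embed ?b + c0_embed (?a /\<^sub>R 2)))"
        unfolding V'_def
      proof (rule in_generator_compose[OF _ A_half])
        show "\<forall>\<^sub>F h in at_right 0. norm (A.mult (h / 2)) \<le> A.K"
          using half A.eventually_norm_mult unfolding filterlim_iff by blast
        show "in_generator (\<lambda>h. B.mult h o\<^sub>L A.mult (h / 2)) (c0_embed f) (c0_embed ?b + c0_embed (?a /\<^sub>R 2))"
          by (rule in_generator_compose[OF B.eventually_norm_mult B.in_generator_mult[OF fB] A_half
                B.mult_strongly_continuous])
        have "((\<lambda>h. A.mult (h / 2) (c0_embed (?b + ?a /\<^sub>R 2))) \<longlongrightarrow> c0_embed (?b + ?a /\<^sub>R 2)) (at_right 0)"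
          by (rule filterlim_compose[OF A.mult_strongly_continuous half])
        then show "((\<lambda>h. A.mult (h / 2) (c0_embed ?b + c0_embed (?a /\<^sub>R 2)))
            \<longlongrightarrow> c0_embed ?b + c0_embed (?a /\<^sub>R 2)) (at_right 0)"
          by (simp add: blinfun.add_right[of c0_embed])
      qed
      moreover have "?a /\<^sub>R 2 + (?b + ?a /\<^sub>R 2) = ?a + ?b"
        by (simp add: algebra_simps flip: scaleR_add_left)
      ultimately show "in_generator V' (c0_embed f) (c0_embed (?a + ?b))"
        by (simp only: blinfun.add_right[symmetric])
    qed
    then show "(\<lambda>n. oprod_dec (\<lambda>p.
               expA (s + real p * (t - s) / real n) ((t - s) / (2 * real n)) o\<^sub>L
               expB (s + real p * (t - s) / real n) ((t - s) / real n) o\<^sub>L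
               expA (s + real p * (t - s) / real n) ((t - s) / (2 * real n))) n x)
             \<longlonglongrightarrow> W t s x"
      by (simp add: V_def mult.commute)
  next
    fix x and t s :: real
    assume stable: "\<forall>t\<ge>0. \<forall>n\<ge>1. \<forall>s.
         1 / 2 ^ n * norm (oprod_inc (\<lambda>p.
             (expA (s - real p * t / real n) (t / real n) o\<^sub>L
              expB (s - real p * t / real n) (t / real n)) +
             (expB (s - real p * t / real n) (t / real n) o\<^sub>L
              expA (s - real p * t / real n) (t / real n))) n)
           \<le> M * exp (\<omega> * t)" and st: "s \<le> t"
    define V where "V = (\<lambda>r h. (1 / 2) *\<^sub>R ((expA r h o\<^sub>L expB r h) + (expB r h o\<^sub>L expA r h)))"
    define V' where "V' = (\<lambda>h. (1 / 2) *\<^sub>R ((A.mult h o\<^sub>L B.mult h) + (B.mult h o\<^sub>L A.mult h)))"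
    have "(\<lambda>n. oprod_dec (\<lambda>p. V (s + real p * ((t - s) / real n)) ((t - s) / real n)) n x)
      \<longlonglongrightarrow> W t s x"
    proof (rule converges[where V' = V' and \<omega> = \<omega>, OF _ _ _ _ st])
      show "bval (V' h \<phi>) r = V r h (bval \<phi> r)" if "h \<ge> 0" for h \<phi> r
        using that by (simp add: V_def V'_def A.bval_mult B.bval_mult blinfun.scaleR_left blinfun.add_left)
      show "V r 0 = id_blinfun" for r
        by (intro blinfun_eqI)
          (simp add: V_def expA_0 expB_0 blinfun.scaleR_left blinfun.add_left flip: scaleR_2)
      show "norm (oprod_inc (\<lambda>p. V (s - real p * h) h) n) \<le> M * exp (\<omega> * (real n * h))"
        if "h > 0" "n \<ge> 1" for h n s
        using stable[rule_format, of "real n * h" n s] that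
        by (simp add: V_def oprod_inc_scaleR power_one_over)
      fix f assume fA: "f \<in> op_dom (mult_operator A)" and fB: "f \<in> op_dom (mult_operator B)"
      let ?a = "op_app (mult_operator A) f" and ?b = "op_app (mult_operator B) f"
      have AB: "in_generator (\<lambda>h. A.mult h o\<^sub>L B.mult h) (c0_embed f) (c0_embed ?a + c0_embed ?b)"
        by (rule in_generator_compose[OF A.eventually_norm_mult A.in_generator_mult[OF fA]
              B.in_generator_mult[OF fB] A.mult_strongly_continuous])
      have BA: "in_generator (\<lambda>h. B.mult h o\<^sub>L A.mult h) (c0_embed f) (c0_embed ?b + c0_embed ?a)"
        by (rule in_generator_compose[OF B.eventually_norm_mult B.in_generator_mult[OF fB]
              A.in_generator_mult[OF fA] B.mult_strongly_continuous])
      show "in_generator V' (c0_embed f) (c0_embed (?a + ?b))"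
        using in_generator_average[OF AB BA] unfolding V'_def
        by (simp add: blinfun.add_right[of c0_embed] add.commute[of "c0_embed ?b"] flip: scaleR_2)
    qed
    then show "(\<lambda>n. (1 / 2 ^ n) *\<^sub>R oprod_dec (\<lambda>p.
               (expA (s + real p * (t - s) / real n) ((t - s) / real n) o\<^sub>L
                expB (s + real p * (t - s) / real n) ((t - s) / real n)) +
               (expB (s + real p * (t - s) / real n) ((t - s) / real n) o\<^sub>L
                expA (s + real p * (t - s) / real n) ((t - s) / real n))) n x)
             \<longlonglongrightarrow> W t s x"
      by (simp add: V_def oprod_dec_scaleR power_one_over blinfun.scaleR_left)
  }
qed

end
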